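(* Let $n\ge2$, let $\Gamma$ be a group and let $\rho:\Gamma\to\mathrm{SO}_0(2,n)$ be a representation. The bounded Euler class $\mathrm{eu}_b(\rho)\in H^2_b(\Gamma,\mathbb{Z})$ vanishes if and only if $\rho$ lifts to a representation $\tilde\rho:\Gamma\to\widetilde{\mathrm{SO}}_0(2,n)$ such that $\tilde\rho(\Gamma)$ preserves a closed $(n-1)$-dimensional achronal topological sphere in $\widetilde{\mathrm{Ein}}_n$.
   Context: $\mathbb{R}^{2,n}$ is $\mathbb{R}^{n+2}$ with $q_{2,n}=-u^2-v^2+x_1^2+\dots+x_n^2$; $\mathrm{SO}_0(2,n)$ is the identity component of its isometry group. $\mathrm{Ein}_n$ is the space of isotropic rays of $\mathbb{R}^{2,n}$, identified with $\mathbb{S}^1\times\mathbb{S}^{n-1}$ by $(\theta,\mathrm{x})\mapsto[\cos\theta,\sin\theta,\mathrm{x}]$, $\theta\in\mathbb{R}/2\pi\mathbb{Z}$, with the conformal class of $-d\theta^2+ds^2$ ($ds^2$ the round metric). $\widetilde{\mathrm{Ein}}_n=\mathbb{R}\times\mathbb{S}^{n-1}$ is its cyclic covering, with deck group generated by $\delta(\theta,\mathrm{x})=(\theta+2\pi,\mathrm{x})$. The closed achronal topological $(n-1)$-spheres in $\widetilde{\mathrm{Ein}}_n$ are exactly the graphs of $1$-Lipschitz functions $f:\mathbb{S}^{n-1}\to\mathbb{R}$ (for the spherical distance). $\widetilde{\mathrm{SO}}_0(2,n)$ is the group of all lifts to $\widetilde{\mathrm{Ein}}_n$ of the transformations of $\mathrm{Ein}_n$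 induced by $\mathrm{SO}_0(2,n)$; it is a central extension $1\to\mathbb{Z}\to\widetilde{\mathrm{SO}}_0(2,n)\to\mathrm{SO}_0(2,n)\to1$ with kernel $\langle\delta\rangle$. Fix $x_0=(0,\mathrm{x}_0)\in\widetilde{\mathrm{Ein}}_n$. For $g\in\mathrm{SO}_0(2,n)$ let $\sigma(g)$ be the unique lift of $g$ such that $\sigma(g)(x_0)\in\{(\theta,\mathrm{x}):-\pi\le\theta<\pi\}$, and let $c(g_1,g_2)$ be the unique integer with $\sigma(g_1g_2)=\delta^{c(g_1,g_2)}\sigma(g_1)\sigma(g_2)$. Then $c$ is a bounded integral $2$-cocycle on $\mathrm{SO}_0(2,n)$, and $\mathrm{eu}_b(\rho):=\rho^*[c]\in H^2_b(\Gamma,\mathbb{Z})$ (bounded cohomology). *)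

theory Defs
  imports "HOL-Analysis.Analysis" "HOL-Algebra.Coset" "HOL-Algebra.Bij"
begin

text \<open>
  The dimension n is \<open>CARD('n)\<close>; a vector of R^{2,n} is written (u, v, x).
\<close>

type_synonym 'n r2n = "real \<times> real \<times> (real ^ 'n)"

definition q2n :: "'n::finite r2n \<Rightarrow> real" where
  "q2n = (\<lambda>(u, v, x). - u\<^sup>2 - v\<^sup>2 + (\<Sum>i\<in>UNIV. (x $ i)\<^sup>2))"

text \<open>
  Since the form is nondegenerate, a linear map preserving it is automatically invertible.
  The topology on linear maps is that of the operator norm.
\<close>

definition O2n :: "('n::finite r2n \<Rightarrow>\<^sub>L 'n r2n) set" where
  "O2n = {A. \<forall>w. q2n (blinfun_apply A w) = q2n w}"

definition SO0 :: "('n::finite r2n \<Rightarrow>\<^sub>L 'n r2n) monoid" where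
  "SO0 = \<lparr>carrier = connected_component_set O2n id_blinfun, mult = (o\<^sub>L), one = id_blinfun\<rparr>"


definition ray :: "'a::real_vector \<Rightarrow> 'a set" where
  "ray w = {t *\<^sub>R w | t. t > 0}"

definition Ein :: "'n::finite r2n set set" where
  "Ein = {ray w | w. w \<noteq> 0 \<and> q2n w = 0}"

definition Ein_cover :: "(real \<times> (real ^ 'n::finite)) set" where
  "Ein_cover = UNIV \<times> sphere 0 1"

definition ein_proj :: "real \<times> (real ^ 'n::finite) \<Rightarrow> 'n r2n set" where
  "ein_proj = (\<lambda>(\<theta>, x). ray (cos \<theta>, sin \<theta>, x))"

lemma ein_proj_image: "ein_proj ` Ein_cover = (Ein :: 'n::finite r2n set set)"
proof
  have norm_sq: "(\<Sum>i\<in>UNIV. (x $ i)\<^sup>2) = (norm x)\<^sup>2" for x :: "real ^ 'n"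
    by (simp add: norm_vec_def L2_set_def sum_nonneg)
  show "ein_proj ` Ein_cover \<subseteq> (Ein :: 'n r2n set set)"
  proof
    fix r :: "'n r2n set"
    assume "r \<in> ein_proj ` Ein_cover"
    then obtain \<theta> and x :: "real ^ 'n" where x: "norm x = 1" and r: "r = ray (cos \<theta>, sin \<theta>, x)"
      by (auto simp: ein_proj_def Ein_cover_def)
    have "q2n (cos \<theta>, sin \<theta>, x) = 0"
      using sin_cos_squared_add[of \<theta>] unfolding q2n_def by (simp add: norm_sq x del: sin_cos_squared_add sin_cos_squared_add2)
    moreover have "(cos \<theta>, sin \<theta>, x) \<noteq> 0"
      using x by (auto simp: zero_prod_def)
    ultimately show "r \<in> Ein"
      unfolding Ein_def r by blast
  qed
  show "(Ein :: 'n r2n set set) \<subseteq> ein_proj ` Ein_cover"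
  proof
    fix r :: "'n r2n set"
    assume "r \<in> Ein"
    then obtain u v and x :: "real ^ 'n"
      where w: "(u, v, x) \<noteq> 0" "q2n (u, v, x) = 0" and r: "r = ray (u, v, x)"
      by (auto simp: Ein_def)
    have eq: "u\<^sup>2 + v\<^sup>2 = (norm x)\<^sup>2"
      using w(2) by (simp add: q2n_def norm_sq)
    have "x \<noteq> 0"
    proof
      assume "x = 0"
      then have "u = 0 \<and> v = 0" using eq by (simp add: sum_power2_eq_zero_iff)
      then show False using w(1) \<open>x = 0\<close> by (simp add: zero_prod_def)
    qed
    define s where "s = norm x"
    have s: "s > 0" using \<open>x \<noteq> 0\<close> by (simp add: s_def)
    have "(u / s)\<^sup>2 + (v / s)\<^sup>2 = 1"
      using eq s by (simp add: power_divide s_def[symmetric] add_divide_distrib[symmetric])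
    then obtain \<theta> where \<theta>: "u / s = cos \<theta>" "v / s = sin \<theta>"
      using sincos_total_2pi by metis
    have "r = ray (cos \<theta>, sin \<theta>, x /\<^sub>R s)"
    proof -
      have e: "(u, v, x) = s *\<^sub>R (cos \<theta>, sin \<theta>, x /\<^sub>R s)"
        using s by (simp add: \<theta>[symmetric])
      have "ray (s *\<^sub>R y) = ray y" for y :: "'n r2n"
      proof -
        have "t *\<^sub>R y \<in> ray (s *\<^sub>R y)" if "t > 0" for t
          unfolding ray_def using that s by (auto intro!: exI[of _ "t / s"])
        moreover have "t *\<^sub>R (s *\<^sub>R y) \<in> ray y" if "t > 0" for t
          unfolding ray_def using that s by (auto intro!: exI[of _ "t * s"])
        ultimately show ?thesis by (auto simp: ray_def)
      qed
      then show ?thesis unfolding r e by blast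
    qed
    moreover have "(\<theta>, x /\<^sub>R s) \<in> Ein_cover"
      using s by (simp add: Ein_cover_def s_def)
    ultimately show "r \<in> ein_proj ` Ein_cover"
      by (force simp: ein_proj_def)
  qed
qed

text \<open>
  The transformation of \<open>Ein\<close> induced by \<open>g\<close> is the image map \<open>r \<mapsto> g ` r\<close> on rays. Transformations
  of \<open>Ein_cover\<close> are extensional functions, i.e. elements of \<open>BijGroup Ein_cover\<close>, so that
  the lifts of \<open>g\<close> are uniquely represented.
\<close>

definition lift_of ::
  "('n::finite r2n \<Rightarrow>\<^sub>L 'n r2n) \<Rightarrow> (real \<times> (real ^ 'n) \<Rightarrow> real \<times> (real ^ 'n)) \<Rightarrow> bool" where
  "lift_of g F \<longleftrightarrow> F \<in> extensional Ein_cover \<and> (\<exists>G. homeomorphism Ein_cover Ein_cover F G) \<and>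
     (\<forall>y\<in>Ein_cover. ein_proj (F y) = blinfun_apply g ` ein_proj y)"

definition SO0_cover :: "(real \<times> (real ^ 'n::finite) \<Rightarrow> real \<times> (real ^ 'n)) monoid" where
  "SO0_cover = (BijGroup Ein_cover)\<lparr>carrier := {F. \<exists>g\<in>carrier SO0. lift_of g F}\<rparr>"

definition deck :: "real \<times> (real ^ 'n::finite) \<Rightarrow> real \<times> (real ^ 'n)" where
  "deck = (\<lambda>(\<theta>, x)\<in>Ein_cover. (\<theta> + 2 * pi, x))"

text \<open>The base point of \<open>Ein_cover\<close> is \<open>(0, x0)\<close>, for a fixed \<open>x0\<close> in the unit sphere.\<close>

definition lift_section ::
  "real ^ 'n::finite \<Rightarrow> ('n r2n \<Rightarrow>\<^sub>L 'n r2n) \<Rightarrow> (real \<times> (real ^ 'n) \<Rightarrow> real \<times> (real ^ 'n))" where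
  "lift_section x0 g = (THE F. lift_of g F \<and> F (0, x0) \<in> {- pi..<pi} \<times> sphere 0 1)"

definition euler_cocycle ::
  "real ^ 'n::finite \<Rightarrow> ('n r2n \<Rightarrow>\<^sub>L 'n r2n) \<times> ('n r2n \<Rightarrow>\<^sub>L 'n r2n) \<Rightarrow> int" where
  "euler_cocycle x0 = (\<lambda>(g1, g2)\<in>carrier SO0 \<times> carrier SO0.
     THE k. lift_section x0 (g1 \<otimes>\<^bsub>SO0\<^esub> g2) =
       (deck [^]\<^bsub>SO0_cover\<^esub> k) \<otimes>\<^bsub>SO0_cover\<^esub> (lift_section x0 g1 \<otimes>\<^bsub>SO0_cover\<^esub> lift_section x0 g2))"


text \<open>
  Degree-two bounded cohomology with trivial integer coefficients, by inhomogeneous cochains.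
\<close>

definition bounded_cochains1 :: "('g, 'm) monoid_scheme \<Rightarrow> ('g \<Rightarrow> int) set" where
  "bounded_cochains1 G =
     {b \<in> carrier G \<rightarrow>\<^sub>E UNIV. \<exists>K. \<forall>g\<in>carrier G. \<bar>b g\<bar> \<le> K}"

definition bounded_cochains2 :: "('g, 'm) monoid_scheme \<Rightarrow> ('g \<times> 'g \<Rightarrow> int) set" where
  "bounded_cochains2 G =
     {\<phi> \<in> carrier G \<times> carrier G \<rightarrow>\<^sub>E UNIV. \<exists>K. \<forall>p\<in>carrier G \<times> carrier G. \<bar>\<phi> p\<bar> \<le> K}"

definition coboundary1 :: "('g, 'm) monoid_scheme \<Rightarrow> ('g \<Rightarrow> int) \<Rightarrow> 'g \<times> 'g \<Rightarrow> int" where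
  "coboundary1 G b = (\<lambda>(g, h)\<in>carrier G \<times> carrier G. b h - b (g \<otimes>\<^bsub>G\<^esub> h) + b g)"

definition bounded_cocycles2 :: "('g, 'm) monoid_scheme \<Rightarrow> ('g \<times> 'g \<Rightarrow> int) set" where
  "bounded_cocycles2 G = {\<phi> \<in> bounded_cochains2 G.
     \<forall>g\<in>carrier G. \<forall>h\<in>carrier G. \<forall>k\<in>carrier G.
       \<phi> (h, k) - \<phi> (g \<otimes>\<^bsub>G\<^esub> h, k) + \<phi> (g, h \<otimes>\<^bsub>G\<^esub> k) - \<phi> (g, h) = 0}"

definition bounded_coboundaries2 :: "('g, 'm) monoid_scheme \<Rightarrow> ('g \<times> 'g \<Rightarrow> int) set" where
  "bounded_coboundaries2 G = coboundary1 G ` bounded_cochains1 G"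

definition bounded_cocycle_group2 :: "('g, 'm) monoid_scheme \<Rightarrow> ('g \<times> 'g \<Rightarrow> int) monoid" where
  "bounded_cocycle_group2 G = \<lparr>carrier = bounded_cocycles2 G,
     mult = (\<lambda>\<phi> \<psi>. \<lambda>p\<in>carrier G \<times> carrier G. \<phi> p + \<psi> p),
     one = (\<lambda>p\<in>carrier G \<times> carrier G. 0)\<rparr>"

definition H2b :: "('g, 'm) monoid_scheme \<Rightarrow> ('g \<times> 'g \<Rightarrow> int) set monoid" where
  "H2b G = bounded_cocycle_group2 G Mod bounded_coboundaries2 G"

definition H2b_class ::
  "('g, 'm) monoid_scheme \<Rightarrow> ('g \<times> 'g \<Rightarrow> int) \<Rightarrow> ('g \<times> 'g \<Rightarrow> int) set" where
  "H2b_class G \<phi> = bounded_coboundaries2 G #>\<^bsub>bounded_cocycle_group2 G\<^esub> \<phi>"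

definition cochain_pullback ::
  "('g, 'm) monoid_scheme \<Rightarrow> ('g \<Rightarrow> 'h) \<Rightarrow> ('h \<times> 'h \<Rightarrow> int) \<Rightarrow> 'g \<times> 'g \<Rightarrow> int" where
  "cochain_pullback G \<rho> \<phi> = (\<lambda>(g, h)\<in>carrier G \<times> carrier G. \<phi> (\<rho> g, \<rho> h))"

definition bounded_euler_class ::
  "real ^ 'n::finite \<Rightarrow> ('g, 'm) monoid_scheme \<Rightarrow> ('g \<Rightarrow> ('n r2n \<Rightarrow>\<^sub>L 'n r2n)) \<Rightarrow>
     ('g \<times> 'g \<Rightarrow> int) set" where
  "bounded_euler_class x0 \<Gamma> \<rho> = H2b_class \<Gamma> (cochain_pullback \<Gamma> \<rho> (euler_cocycle x0))"


text \<open>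
  Timelike means negative for the metric \<open>-d\<theta>\<^sup>2 + ds\<^sup>2\<close>, which depends only on its conformal class;
  the round metric \<open>ds\<^sup>2\<close> is the restriction of the Euclidean one. \<open>C1_differentiable_on\<close> takes
  two-sided derivatives at the end points of the interval: values of the curve outside the
  interval are unconstrained otherwise, so this just says that it is C^1 up to the end points.
\<close>

definition timelike_curve :: "(real \<Rightarrow> real \<times> (real ^ 'n::finite)) \<Rightarrow> bool" where
  "timelike_curve c \<longleftrightarrow> c C1_differentiable_on {0..1} \<and> c ` {0..1} \<subseteq> Ein_cover \<and>
     (\<forall>t\<in>{0..1}. - (fst (vector_derivative c (at t)))\<^sup>2 + (norm (snd (vector_derivative c (at t))))\<^sup>2 < 0)"

definition achronal :: "(real \<times> (real ^ 'n::finite)) set \<Rightarrow> bool" where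
  "achronal \<Lambda> \<longleftrightarrow> \<not> (\<exists>c. timelike_curve c \<and> c 0 \<in> \<Lambda> \<and> c 1 \<in> \<Lambda>)"

definition closed_achronal_sphere :: "(real \<times> (real ^ 'n::finite)) set \<Rightarrow> bool" where
  "closed_achronal_sphere \<Lambda> \<longleftrightarrow> \<Lambda> \<subseteq> Ein_cover \<and> closed \<Lambda> \<and> achronal \<Lambda> \<and>
     \<Lambda> homeomorphic sphere (0 :: real ^ 'n) 1"

end

theory Submission
  imports Defs
begin

text \<open>
  Order \<open>Ein_cover\<close> by \<open>chron p q\<close>, which says that \<open>q\<close> is above \<open>p\<close> by more than the spherical
  distance of their second components. Every lift of an element of \<open>SO0\<close> is an automorphism of this
  order and commutes with the translations \<open>shift k\<close> by \<open>2 \<pi> k\<close> (\<open>lift_chron_iff\<close>,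
  \<open>weak_lift_equivariant\<close>). The two facts together make lifts behave like lifts of circle
  homeomorphisms to the line: the vertical displacement of a lift varies by less than \<open>3 \<pi>\<close>
  over the whole space (\<open>lift_displacement_oscillation\<close>), so that the height of the image of a single
  point controls the lift everywhere. The proof is then the one for the bounded Euler class of a
  group acting on the circle, with achronal spheres in place of fixed points.

  If the pulled back cocycle is the coboundary of a bounded cochain \<open>b\<close>, then multiplying the section
  \<open>\<sigma>\<close> by \<open>\<delta>\<close> to the power \<open>b\<close> gives a homomorphism \<open>\<rho>'\<close> for which the orbit of the base point
  has bounded height. The points lying in the chronological past of that orbit are those under
  the graph of a bounded 1-Lipschitz function \<open>f\<close> (\<open>past_boundary_height\<close>), this region is
  determined by the orbit and the order alone, and so is its upper boundary
  (\<open>height_graph_order_characterization\<close>). Hence the graph of \<open>f\<close>, a closed achronal sphere, is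
  invariant under \<open>\<rho>'\<close>.

  Conversely, a lift \<open>\<rho>'\<close> differs from \<open>\<sigma>\<close> by powers of \<open>\<delta>\<close>; the negatives of the exponents of
  \<open>\<sigma>\<close> relative to \<open>\<rho>'\<close> form a cochain with coboundary the pulled back cocycle. An invariant sphere is compact, so \<open>\<rho>'\<close> moves its points
  by a bounded amount; therefore it moves the base point by a bounded amount, and the
  exponents are bounded.

  Lifts preserve the order because an isometry preserves the sign of
  \<open>x \<bullet> x' - cos (\<theta>' - \<theta>)\<close>, the scalar product of two null vectors. This determines the causal relation
  of two points up to \<open>2 \<pi>\<close> in the angle, and the ambiguity is removed by continuity along paths
  that do not meet the set where the angles of the image points differ by \<open>\<pi>\<close>
  (\<open>lift_preserves_acausal\<close>, \<open>lift_preserves_chron\<close>).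
\<close>

section \<open>Spherical distance\<close>

definition sdist :: "'a::real_inner \<Rightarrow> 'a \<Rightarrow> real" where
  "sdist x y = arccos (x \<bullet> y)"

lemma inner_sphere_bounds:
  assumes "norm x = 1" "norm y = 1"
  shows "- 1 \<le> x \<bullet> y" "x \<bullet> y \<le> 1"
  using Cauchy_Schwarz_ineq2[of x y] assms by auto

lemma sdist_bounds:
  assumes "norm x = 1" "norm y = 1"
  shows "0 \<le> sdist x y" "sdist x y \<le> pi"
  using inner_sphere_bounds[OF assms] by (auto simp: sdist_def arccos_lbound arccos_ubound)

lemma cos_sdist:
  assumes "norm x = 1" "norm y = 1"
  shows "cos (sdist x y) = x \<bullet> y"
  using inner_sphere_bounds[OF assms] by (simp add: sdist_def cos_arccos)

lemma sdist_self [simp]: "norm x = 1 \<Longrightarrow> sdist x x = 0"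
  by (simp add: sdist_def norm_eq_1)

lemma sdist_commute: "sdist x y = sdist y x"
  by (simp add: sdist_def inner_commute)

text \<open>
  The part of \<open>x\<close> orthogonal to \<open>y\<close> has the length of the opposite side of a right triangle with
  angle \<open>sdist x y\<close>; this is what bounds the error term in the spherical law of cosines below.
\<close>

lemma norm_minus_cos_scale:
  assumes "norm x = 1" "norm y = 1"
  shows "norm (x - (x \<bullet> y) *\<^sub>R y) = sin (sdist x y)"
proof -
  have "(norm (x - (x \<bullet> y) *\<^sub>R y))\<^sup>2 = 1 - (x \<bullet> y)\<^sup>2"
    unfolding power2_norm_eq_inner using assms
    by (simp add: norm_eq_1 inner_diff_left inner_diff_right inner_commute[of y x]
        power2_eq_square)
  also have "\<dots> = (sin (sdist x y))\<^sup>2"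
    by (simp add: sin_squared_eq cos_sdist[OF assms])
  finally show ?thesis
    using sdist_bounds[OF assms] by (simp add: power2_eq_iff_nonneg sin_ge_zero)
qed

text \<open>
  Splitting \<open>x\<close> and \<open>z\<close> into components along \<open>y\<close> and orthogonal to it gives
  \<open>x \<bullet> z = cos a cos b + v \<bullet> w\<close> with \<open>\<bar>v \<bullet> w\<bar> \<le> sin a sin b\<close>, hence \<open>x \<bullet> z \<ge> cos (a + b)\<close>.
\<close>

lemma sdist_triangle:
  assumes x: "norm x = 1" and y: "norm y = 1" and z: "norm z = 1"
  shows "sdist x z \<le> sdist x y + sdist y z"
proof (cases "sdist x y + sdist y z \<le> pi")
  case False
  then show ?thesis using sdist_bounds[OF x z] by simp
next
  case True
  define a b where "a = sdist x y" and "b = sdist z y"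
  define v w where "v = x - (x \<bullet> y) *\<^sub>R y" and "w = z - (z \<bullet> y) *\<^sub>R y"
  have "x \<bullet> z = (x \<bullet> y) * (z \<bullet> y) + v \<bullet> w"
    using y by (simp add: v_def w_def inner_diff_left inner_diff_right norm_eq_1 inner_commute algebra_simps)
  moreover have "\<bar>v \<bullet> w\<bar> \<le> sin a * sin b"
    using Cauchy_Schwarz_ineq2[of v w]
    by (simp add: v_def w_def a_def b_def norm_minus_cos_scale x y z)
  ultimately have "cos (a + b) \<le> x \<bullet> z"
    by (simp add: cos_add a_def b_def cos_sdist x y z)
  also have "x \<bullet> z = cos (sdist x z)" by (simp add: cos_sdist x z)
  finally have "cos (a + b) \<le> cos (sdist x z)" .
  moreover have "0 \<le> a + b" "a + b \<le> pi"
    using True sdist_bounds[OF x y] sdist_bounds[OF z y] by (auto simp: a_def b_def sdist_commute)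
  ultimately show ?thesis
    using cos_mono_le_eq[of "a + b" "sdist x z"] sdist_bounds[OF x z]
    by (auto simp: a_def b_def sdist_commute)
qed

text \<open>
  Points at spherical distance \<open>d\<close> have chord \<open>2 sin (d / 2)\<close>. Chords, unlike angles, are differentiable
  along a curve at its starting point.
\<close>

lemma sdist_less_if_chord_less:
  assumes "norm x = 1" "norm y = 1" "0 \<le> t" "t \<le> pi" "norm (y - x) < 2 * sin (t / 2)"
  shows "sdist x y < t"
proof -
  have "(norm (y - x))\<^sup>2 = 2 - 2 * (x \<bullet> y)"
    unfolding power2_norm_eq_inner using assms
    by (simp add: norm_eq_1 inner_diff_left inner_diff_right inner_commute[of y x])
  moreover have "(norm (y - x))\<^sup>2 < (2 * sin (t / 2))\<^sup>2"
    using assms by (intro power_strict_mono) auto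
  moreover have "(2 * sin (t / 2))\<^sup>2 = 2 - 2 * cos t"
    using cos_double_sin[of "t / 2"] by (simp add: power_mult_distrib)
  ultimately have "cos t < cos (sdist x y)" by (simp add: cos_sdist assms)
  then show ?thesis
    using cos_mono_less_eq[of t "sdist x y"] sdist_bounds[OF assms(1,2)] assms by simp
qed

section \<open>Graphs of 1-Lipschitz functions are closed achronal spheres\<close>

text \<open>
  The condition is one-sided, but symmetric in \<open>x\<close> and \<open>y\<close>, so it says that \<open>f\<close> is 1-Lipschitz on the
  sphere for the spherical distance.
\<close>

definition lipschitz_height :: "(real ^ 'n::finite \<Rightarrow> real) \<Rightarrow> bool" where
  "lipschitz_height f \<longleftrightarrow>
     (\<forall>x\<in>sphere 0 1. \<forall>y\<in>sphere 0 1. f x - f y \<le> sdist x y)"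

definition height_graph :: "(real ^ 'n::finite \<Rightarrow> real) \<Rightarrow> (real \<times> (real ^ 'n)) set" where
  "height_graph f = (\<lambda>x. (f x, x)) ` sphere 0 1"

lemma lipschitz_height_continuous:
  fixes f :: "real ^ 'n::finite \<Rightarrow> real"
  assumes "lipschitz_height f"
  shows "continuous_on (sphere 0 1) f"
  unfolding continuous_on
proof
  fix x :: "real ^ 'n" assume x: "x \<in> sphere 0 1"
  have "((\<lambda>y. x \<bullet> y) \<longlongrightarrow> x \<bullet> x) (at x within sphere 0 1)"
    by (intro tendsto_intros)
  then have lim: "((\<lambda>y. sdist x y) \<longlongrightarrow> sdist x x) (at x within sphere 0 1)"
    unfolding sdist_def using x inner_sphere_bounds
    by (intro continuous_on_tendsto_compose[OF continuous_on_arccos'])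
      (auto simp: eventually_at_filter norm_eq_1 intro!: always_eventually)
  show "(f \<longlongrightarrow> f x) (at x within sphere 0 1)"
  proof (rule Lim_null_comparison[of "\<lambda>y. f y - f x", THEN LIM_zero_cancel])
    show "\<forall>\<^sub>F y in at x within sphere 0 1. norm (f y - f x) \<le> sdist x y"
      using assms x unfolding lipschitz_height_def
      by (auto simp: eventually_at_filter sdist_commute abs_le_iff intro!: always_eventually)
        (metis sdist_commute mem_sphere_0 minus_diff_eq)+
    show "((\<lambda>y. sdist x y) \<longlongrightarrow> 0) (at x within sphere 0 1)" using lim x by simp
  qed
qed

text \<open>
  At a point where \<open>h\<close> attains its maximum over \<open>{u..b}\<close>, it cannot increase to the right, so that point
  is \<open>b\<close>. The growth condition is stated without derivatives because \<open>h\<close> will be built from a function that is only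
  Lipschitz.
\<close>

lemma less_if_right_locally_increasing:
  fixes h :: "real \<Rightarrow> real"
  assumes "a < b" and cont: "continuous_on {a..b} h"
    and loc: "\<And>t. a \<le> t \<Longrightarrow> t < b \<Longrightarrow> \<forall>\<^sub>F s in at_right t. h t < h s"
  shows "h a < h b"
proof -
  have weak: "h u \<le> h b" if u: "a \<le> u" "u \<le> b" for u
  proof (rule ccontr)
    assume less: "\<not> h u \<le> h b"
    have "continuous_on {u..b} h" using cont u by (auto intro: continuous_on_subset)
    then obtain t where t: "t \<in> {u..b}" and max: "\<And>s. s \<in> {u..b} \<Longrightarrow> h s \<le> h t"
      using continuous_attains_sup[of "{u..b}" h] u by auto
    have "t < b" using t less max[of u] u by (cases "t = b") auto
    then have "\<forall>\<^sub>F s in at_right t. s < b \<and> t < s"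
      by (auto intro: eventually_conj eventually_at_right_less order_tendstoD eventually_at_rightI)
    moreover have "\<forall>\<^sub>F s in at_right t. h t < h s" using loc t u \<open>t < b\<close> by auto
    ultimately have "\<forall>\<^sub>F s in at_right t. False"
    proof eventually_elim
      case (elim s)
      then show False using max[of s] t by auto
    qed
    then show False by simp
  qed
  have "\<forall>\<^sub>F s in at_right a. s < b \<and> a < s" using \<open>a < b\<close>
    by (auto intro: eventually_conj eventually_at_right_less order_tendstoD eventually_at_rightI)
  moreover have "\<forall>\<^sub>F s in at_right a. h a < h s" using loc \<open>a < b\<close> by auto
  ultimately have "\<forall>\<^sub>F s in at_right a. s < b \<and> a < s \<and> h a < h s" by eventually_elim auto
  then obtain s where "s < b" "a < s" "h a < h s"
    using eventually_happens'[of "at_right a"] by force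
  then show ?thesis using weak[of s] by simp
qed

lemma nonneg_if_sin_half_pos:
  fixes d :: real
  assumes "- pi < d" "0 < sin (d / 2)"
  shows "0 \<le> d"
proof (rule ccontr)
  assume "\<not> 0 \<le> d"
  then have "0 \<le> sin (- (d / 2))" using assms(1) pi_gt_zero by (intro sin_ge_zero) simp_all
  then show False using assms(2) by (simp only: sin_minus)
qed

text \<open>
  To first order at \<open>t\<close>, the angle advances with speed \<open>\<theta>'\<close> and the chord on the sphere grows with the
  smaller speed \<open>norm x'\<close>. The angle is compared with the chord through \<open>2 sin (\<Delta>\<theta> / 2)\<close>, which
  also has derivative \<open>\<theta>'\<close> at \<open>t\<close>.
\<close>

lemma future_timelike_steps_locally:
  fixes x :: "real \<Rightarrow> real ^ 'n::finite"
  assumes \<theta>: "(\<theta> has_real_derivative \<theta>') (at t)" and x: "(x has_vector_derivative x') (at t)"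
    and less: "norm x' < \<theta>'" and sph: "\<forall>\<^sub>F s in at_right t. norm (x s) = 1" "norm (x t) = 1"
  shows "\<forall>\<^sub>F s in at_right t. sdist (x t) (x s) < \<theta> s - \<theta> t"
proof -
  have "((\<lambda>s. 2 * sin ((\<theta> s - \<theta> t) / 2)) has_real_derivative \<theta>') (at t)"
    using \<theta> by (auto intro!: derivative_eq_intros)
  then have "((\<lambda>s. (2 * sin ((\<theta> s - \<theta> t) / 2)) / (s - t)) \<longlongrightarrow> \<theta>') (at_right t)"
    by (auto simp: has_field_derivative_iff intro: filterlim_mono at_le)
  moreover have "((\<lambda>s. norm ((x s - x t) /\<^sub>R (s - t))) \<longlongrightarrow> norm x') (at_right t)"
  proof -
    have "(x has_vector_derivative x') (at t within {t<..})"
      using x by (rule has_vector_derivative_at_within)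
    then have "((\<lambda>s. (1 / norm (s - t)) *\<^sub>R (x s - (x t + (s - t) *\<^sub>R x'))) \<longlongrightarrow> 0) (at_right t)"
      by (simp add: has_vector_derivative_def has_derivative_within)
    then have "((\<lambda>s. x' + (1 / norm (s - t)) *\<^sub>R (x s - (x t + (s - t) *\<^sub>R x'))) \<longlongrightarrow> x' + 0) (at_right t)"
      by (intro tendsto_intros)
    moreover have "\<forall>\<^sub>F s in at_right t. x' + (1 / norm (s - t)) *\<^sub>R (x s - (x t + (s - t) *\<^sub>R x')) = (x s - x t) /\<^sub>R (s - t)"
      using eventually_at_right_less[of t]
    proof eventually_elim
      case (elim s)
      then have "(1 / norm (s - t)) *\<^sub>R ((s - t) *\<^sub>R x') = x'" by simp
      then show ?case using elim
        by (simp only: scaleR_right_diff_distrib scaleR_right_distrib) (simp add: divide_inverse_commute)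
    qed
    ultimately have "((\<lambda>s. (x s - x t) /\<^sub>R (s - t)) \<longlongrightarrow> x') (at_right t)"
      by (simp add: tendsto_cong)
    then show ?thesis by (rule tendsto_norm)
  qed
  ultimately have "((\<lambda>s. (2 * sin ((\<theta> s - \<theta> t) / 2)) / (s - t) - norm ((x s - x t) /\<^sub>R (s - t)))
      \<longlongrightarrow> \<theta>' - norm x') (at_right t)"
    by (rule tendsto_diff)
  then have chord: "\<forall>\<^sub>F s in at_right t.
      0 < (2 * sin ((\<theta> s - \<theta> t) / 2)) / (s - t) - norm ((x s - x t) /\<^sub>R (s - t))"
    using less by (intro order_tendstoD(1)) auto
  have "((\<lambda>s. \<theta> s - \<theta> t) \<longlongrightarrow> \<theta> t - \<theta> t) (at_right t)"
    using DERIV_isCont[OF \<theta>] by (intro tendsto_intros) (auto simp: isCont_def intro: tendsto_mono[OF at_le])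
  then have small: "\<forall>\<^sub>F s in at_right t. \<theta> s - \<theta> t < pi" "\<forall>\<^sub>F s in at_right t. - pi < \<theta> s - \<theta> t"
    by (auto intro!: order_tendstoD)
  show ?thesis
    using chord small sph(1) eventually_at_right_less[of t]
  proof eventually_elim
    case (elim s)
    then have less: "norm (x s - x t) < 2 * sin ((\<theta> s - \<theta> t) / 2)"
      by (simp add: divide_inverse[symmetric] diff_divide_distrib[symmetric] divide_simps)
    then have "0 < sin ((\<theta> s - \<theta> t) / 2)"
      using norm_ge_zero[of "x s - x t"] by linarith
    then have "0 \<le> \<theta> s - \<theta> t"
      using elim(2,3) by (intro nonneg_if_sin_half_pos) simp_all
    then show ?case
      using less elim sph(2) by (intro sdist_less_if_chord_less) auto
  qed
qed

text \<open>
  Over a short step the angle gains more than the spherical distance travelled, hence more than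
  \<open>f\<close> can change. So the height above the graph of \<open>f\<close> increases strictly along the curve.
\<close>

lemma future_timelike_raises_lipschitz_height:
  fixes x :: "real \<Rightarrow> real ^ 'n::finite"
  assumes f: "lipschitz_height f"
    and \<theta>: "\<And>t. t \<in> {0..1} \<Longrightarrow> (\<theta> has_real_derivative \<theta>' t) (at t)"
    and x: "\<And>t. t \<in> {0..1} \<Longrightarrow> (x has_vector_derivative x' t) (at t)"
    and timelike: "\<And>t. t \<in> {0..1} \<Longrightarrow> norm (x' t) < \<theta>' t"
    and sph: "\<And>t. t \<in> {0..1} \<Longrightarrow> norm (x t) = 1"
  shows "\<theta> 0 - f (x 0) < \<theta> 1 - f (x 1)"
proof (rule less_if_right_locally_increasing[where h = "\<lambda>t. \<theta> t - f (x t)"])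
  have "continuous_on {0..1} x"
    using x by (meson continuous_at_imp_continuous_on has_vector_derivative_continuous)
  moreover have fc: "continuous_on (x ` {0..1}) f"
    using sph by (intro continuous_on_subset[OF lipschitz_height_continuous[OF f]]) auto
  ultimately have "continuous_on {0..1} (\<lambda>t. f (x t))"
    by (intro continuous_on_compose2[OF fc _ order_refl])
  moreover have "continuous_on {0..1} \<theta>"
    using \<theta> by (meson continuous_at_imp_continuous_on DERIV_isCont)
  ultimately show "continuous_on {0..1} (\<lambda>t. \<theta> t - f (x t))"
    by (intro continuous_on_diff)
  fix t :: real assume t: "0 \<le> t" "t < 1"
  have "\<forall>\<^sub>F s in at_right t. s \<in> {t<..<1}" using t by (intro eventually_at_right_real) auto
  then have "\<forall>\<^sub>F s in at_right t. norm (x s) = 1"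
    by eventually_elim (use sph t in auto)
  then have "\<forall>\<^sub>F s in at_right t. norm (x s) = 1 \<and> sdist (x t) (x s) < \<theta> s - \<theta> t"
    using t by (intro eventually_conj future_timelike_steps_locally[OF \<theta> x timelike _ sph]) auto
  then show "\<forall>\<^sub>F s in at_right t. \<theta> t - f (x t) < \<theta> s - f (x s)"
  proof eventually_elim
    case (elim s)
    then have "f (x s) - f (x t) \<le> sdist (x s) (x t)"
      using f t sph[of t] unfolding lipschitz_height_def by auto
    then show ?case using elim by (simp add: sdist_commute)
  qed
qed simp

lemma lipschitz_height_minus:
  fixes f :: "real ^ 'a::finite \<Rightarrow> real"
  shows "lipschitz_height f \<Longrightarrow> lipschitz_height (\<lambda>x. - f x)"
  unfolding lipschitz_height_def
proof (intro ballI)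
  fix x y :: "real ^ 'a"
  assume "\<forall>x\<in>sphere 0 1. \<forall>y\<in>sphere 0 1. f x - f y \<le> sdist x y" "x \<in> sphere 0 1" "y \<in> sphere 0 1"
  then have "f y - f x \<le> sdist y x" by blast
  then show "- f x - - f y \<le> sdist x y" by (simp add: sdist_commute)
qed

lemma connected_real_sign:
  fixes h :: "'a \<Rightarrow> real"
  assumes "connected (h ` A)" "\<And>t. t \<in> A \<Longrightarrow> h t \<noteq> 0"
  shows "(\<forall>t\<in>A. 0 < h t) \<or> (\<forall>t\<in>A. h t < 0)"
proof (rule ccontr)
  assume "\<not> ?thesis"
  then obtain s t where st: "s \<in> A" "t \<in> A" "h s \<le> 0" "0 \<le> h t"
    by (auto simp: not_less)
  have "0 \<in> h ` A"
    by (rule connectedD_interval[OF assms(1) imageI[OF st(1)] imageI[OF st(2)] st(3,4)])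
  then show False using assms(2) by auto
qed

text \<open>
  The derivative of the angle along a timelike curve has no zero, hence a constant sign. A future directed
  curve rises strictly from the graph and does not return to it; a past directed one
  becomes future directed after reflecting the curve and \<open>f\<close> in the angle \<open>0\<close>.
\<close>

lemma height_graph_achronal:
  fixes f :: "real ^ 'n::finite \<Rightarrow> real"
  assumes f: "lipschitz_height f"
  shows "achronal (height_graph f)"
  unfolding achronal_def
proof (safe)
  fix c :: "real \<Rightarrow> real \<times> (real ^ 'n)"
  assume c: "timelike_curve c" and c0: "c 0 \<in> height_graph f" and c1: "c 1 \<in> height_graph f"
  define D where "D = (\<lambda>t. vector_derivative c (at t))"
  have D: "(c has_vector_derivative D t) (at t)" if "t \<in> {0..1}" for t
    using c that by (auto simp: timelike_curve_def C1_differentiable_on_eq D_def vector_derivative_works)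
  have cont: "continuous_on {0..1} D"
    using c by (auto simp: timelike_curve_def C1_differentiable_on_eq D_def)
  have tl: "(norm (snd (D t)))\<^sup>2 < (fst (D t))\<^sup>2" if "t \<in> {0..1}" for t
    using c that by (auto simp: timelike_curve_def D_def)
  have \<theta>: "((\<lambda>t. fst (c t)) has_real_derivative fst (D t)) (at t)" if "t \<in> {0..1}" for t
    using bounded_linear.has_vector_derivative[OF bounded_linear_fst D[OF that]]
    by (simp add: has_real_derivative_iff_has_vector_derivative)
  have x: "((\<lambda>t. snd (c t)) has_vector_derivative snd (D t)) (at t)" if "t \<in> {0..1}" for t
    using bounded_linear.has_vector_derivative[OF bounded_linear_snd D[OF that]] .
  have sph: "norm (snd (c t)) = 1" if "t \<in> {0..1}" for t
    using c that by (auto simp: timelike_curve_def Ein_cover_def image_subset_iff mem_Times_iff)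
  have ends: "fst (c 0) = f (snd (c 0))" "fst (c 1) = f (snd (c 1))"
    using c0 c1 by (auto simp: height_graph_def)
  have nz: "fst (D t) \<noteq> 0" if "t \<in> {0..1}" for t using tl[OF that] by auto
  have "connected ((\<lambda>t. fst (D t)) ` {0..1})"
    by (intro connected_continuous_image continuous_on_fst cont) auto
  then have "(\<forall>t\<in>{0..1}. 0 < fst (D t)) \<or> (\<forall>t\<in>{0..1}. fst (D t) < 0)"
    using nz by (rule_tac connected_real_sign)
  then show False
  proof
    assume "\<forall>t\<in>{0..1}. 0 < fst (D t)"
    then have "norm (snd (D t)) < fst (D t)" if "t \<in> {0..1}" for t
      using that tl[OF that] by (intro power2_less_imp_less[of "norm (snd (D t))"]) (auto simp: less_imp_le)
    from future_timelike_raises_lipschitz_height[OF f \<theta> x this sph] show False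
      using ends by simp
  next
    assume "\<forall>t\<in>{0..1}. fst (D t) < 0"
    then have "norm (snd (D t)) < - fst (D t)" if "t \<in> {0..1}" for t
      using that tl[OF that] by (intro power2_less_imp_less[of "norm (snd (D t))"]) (auto simp: less_imp_le)
    from future_timelike_raises_lipschitz_height[OF lipschitz_height_minus[OF f] DERIV_minus[OF \<theta>] x this sph]
    show False using ends by simp
  qed
qed

lemma height_graph_closed_achronal_sphere:
  fixes f :: "real ^ 'n::finite \<Rightarrow> real"
  assumes f: "lipschitz_height f"
  shows "closed_achronal_sphere (height_graph f)"
proof -
  have cont: "continuous_on (sphere 0 1) (\<lambda>x. (f x, x))"
    using lipschitz_height_continuous[OF f] by (rule continuous_on_Pair) (rule continuous_on_id)
  have "homeomorphism (sphere 0 1) (height_graph f) (\<lambda>x. (f x, x)) snd"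
    unfolding height_graph_def
    by (intro homeomorphismI cont) (auto intro!: continuous_intros)
  then have "sphere (0 :: real ^ 'n) 1 homeomorphic height_graph f"
    unfolding homeomorphic_def by blast
  moreover have "closed (height_graph f)"
    unfolding height_graph_def by (intro compact_imp_closed compact_continuous_image cont) auto
  ultimately show ?thesis
    unfolding closed_achronal_sphere_def
    using height_graph_achronal[OF f] homeomorphic_sym
    by (auto simp: height_graph_def Ein_cover_def)
qed

section \<open>The identity component of the isometry group\<close>

lemma q2n_eq: "q2n (u, v, x) = (norm x)\<^sup>2 - u\<^sup>2 - v\<^sup>2"
  by (simp add: q2n_def norm_vec_def L2_set_def sum_nonneg)

lemma O2n_q2n: "g \<in> O2n \<Longrightarrow> q2n (blinfun_apply g w) = q2n w"
  unfolding O2n_def by blast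

lemma O2nI: "(\<And>w. q2n (blinfun_apply g w) = q2n w) \<Longrightarrow> g \<in> O2n"
  unfolding O2n_def by blast

text \<open>
  If \<open>g w = 0\<close>, the form is invariant under translation by \<open>w\<close>. Comparing its values at \<open>(u, v, - x)\<close> and
  \<open>(u, v, - x) + w = (2 u, 2 v, 0)\<close> yields a positive definite expression in \<open>w = (u, v, x)\<close> that vanishes.
\<close>

lemma O2n_kernel_trivial:
  assumes g: "g \<in> O2n" and w: "blinfun_apply g w = 0"
  shows "w = 0"
proof -
  have shift: "q2n (w + w') = q2n w'" for w'
    using O2n_q2n[OF g, of "w + w'"] O2n_q2n[OF g, of w'] by (simp add: blinfun.add_right w)
  obtain u v x where eq: "w = (u, v, x)" by (cases w)
  have "3 * (u\<^sup>2 + v\<^sup>2) + (norm x)\<^sup>2 = 0"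
    using shift[of "(u, v, - x)"] by (simp add: eq q2n_eq power2_eq_square algebra_simps)
  moreover have "0 \<le> u\<^sup>2" "0 \<le> v\<^sup>2" "0 \<le> (norm x)\<^sup>2" by simp_all
  ultimately have "u\<^sup>2 = 0 \<and> v\<^sup>2 = 0 \<and> (norm x)\<^sup>2 = 0" by (smt (verit))
  then show ?thesis by (simp add: eq zero_prod_def)
qed

lemma O2n_inj: "g \<in> O2n \<Longrightarrow> inj (blinfun_apply g)"
  using O2n_kernel_trivial
  by (auto simp: linear_injective_0 blinfun.bounded_linear_right bounded_linear.linear)

lemma O2n_id: "id_blinfun \<in> O2n"
  by (rule O2nI) simp

lemma O2n_compose: "g \<in> O2n \<Longrightarrow> h \<in> O2n \<Longrightarrow> g o\<^sub>L h \<in> O2n"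
  by (rule O2nI) (simp add: O2n_q2n)

lemma O2n_inverse:
  assumes g: "g \<in> O2n"
  obtains h where "h \<in> O2n" "h o\<^sub>L g = id_blinfun" "g o\<^sub>L h = id_blinfun"
proof -
  have "linear (blinfun_apply g)"
    by (simp add: blinfun.bounded_linear_right bounded_linear.linear)
  then obtain f where f: "linear f" "\<And>w. f (blinfun_apply g w) = w" "\<And>w. blinfun_apply g (f w) = w"
    using linear_injective_isomorphism[OF _ O2n_inj[OF g]] by blast
  have app: "blinfun_apply (Blinfun f) = f"
    using f(1) by (simp add: bounded_linear_Blinfun_apply linear_conv_bounded_linear)
  show ?thesis
  proof
    show "Blinfun f \<in> O2n"
    proof (rule O2nI)
      fix w
      show "q2n (blinfun_apply (Blinfun f) w) = q2n w"
        using O2n_q2n[OF g, of "f w"] by (simp add: app f(3))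
    qed
    show "Blinfun f o\<^sub>L g = id_blinfun" "g o\<^sub>L Blinfun f = id_blinfun"
      by (auto intro!: blinfun_eqI simp: app f)
  qed
qed

lemma carrier_SO0: "carrier SO0 = connected_component_set O2n id_blinfun"
  by (simp add: SO0_def)

lemma mult_SO0 [simp]:
  "mult SO0 = (o\<^sub>L)"
  by (simp add: SO0_def)

lemma SO0_subset_O2n: "g \<in> carrier SO0 \<Longrightarrow> g \<in> O2n"
  using connected_component_subset unfolding carrier_SO0 by blast

text \<open>
  Left translation by \<open>g\<close> maps the component of the identity onto a connected set; if this meets the component,
  it lies inside. The cases where \<open>h\<close> or the composite of \<open>g\<close> and \<open>h\<close> is the identity give closure under products and
  inverses.
\<close>

lemma O2n_component_translate:
  assumes g: "g \<in> O2n" and h: "h \<in> carrier SO0" and gh: "g o\<^sub>L h \<in> carrier SO0"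
    and k: "k \<in> carrier SO0"
  shows "g o\<^sub>L k \<in> carrier SO0"
proof -
  let ?C = "connected_component_set O2n id_blinfun"
  have "connected ((\<lambda>k. g o\<^sub>L k) ` ?C)"
    by (intro connected_continuous_image continuous_intros) simp
  moreover have "(\<lambda>k. g o\<^sub>L k) ` ?C \<subseteq> O2n"
    using O2n_compose[OF g] connected_component_subset by auto
  moreover have "g o\<^sub>L h \<in> (\<lambda>k. g o\<^sub>L k) ` ?C" using h unfolding carrier_SO0 by (rule imageI)
  ultimately have "(\<lambda>k. g o\<^sub>L k) ` ?C \<subseteq> connected_component_set O2n (g o\<^sub>L h)"
    by (intro connected_component_maximal)
  also have "\<dots> = ?C" using gh unfolding carrier_SO0 by (rule connected_component_eq)
  finally show ?thesis using k unfolding carrier_SO0 by blast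
qed

lemma SO0_id: "id_blinfun \<in> carrier SO0"
  unfolding carrier_SO0 by (simp add: O2n_id connected_component_refl)

lemma SO0_compose:
  assumes "g \<in> carrier SO0" "h \<in> carrier SO0"
  shows "g o\<^sub>L h \<in> carrier SO0"
proof (rule O2n_component_translate[OF SO0_subset_O2n[OF assms(1)] SO0_id _ assms(2)])
  have "g o\<^sub>L id_blinfun = g" by (rule blinfun_eqI) simp
  then show "g o\<^sub>L id_blinfun \<in> carrier SO0" using assms(1) by simp
qed

lemma SO0_inverse:
  assumes g: "g \<in> carrier SO0"
  obtains h where "h \<in> carrier SO0" "h o\<^sub>L g = id_blinfun" "g o\<^sub>L h = id_blinfun"
proof -
  obtain h where h: "h \<in> O2n" "h o\<^sub>L g = id_blinfun" "g o\<^sub>L h = id_blinfun"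
    using O2n_inverse[OF SO0_subset_O2n[OF g]] by blast
  have "h o\<^sub>L g \<in> carrier SO0" unfolding h(2) by (rule SO0_id)
  then have "h o\<^sub>L id_blinfun \<in> carrier SO0"
    by (rule O2n_component_translate[OF h(1) g _ SO0_id])
  moreover have "h o\<^sub>L id_blinfun = h" by (rule blinfun_eqI) simp
  ultimately show ?thesis using h(2,3) that by simp
qed

section \<open>Continuous angle functions of isometries\<close>

definition null_vec :: "real \<times> (real ^ 'n::finite) \<Rightarrow> 'n r2n" where
  "null_vec = (\<lambda>(\<theta>, x). (cos \<theta>, sin \<theta>, x))"

definition time_part :: "'n::finite r2n \<Rightarrow> complex" where
  "time_part = (\<lambda>(u, v, x). Complex u v)"

definition sphere_part :: "'n::finite r2n \<Rightarrow> real ^ 'n" where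
  "sphere_part = (\<lambda>(u, v, x). x)"

lemma time_part_linear:
  "time_part (w + w') = time_part w + time_part w'"
  "time_part (w - w') = time_part w - time_part w'"
  "time_part (t *\<^sub>R w) = t *\<^sub>R time_part w"
  by (cases w; cases w'; simp add: time_part_def complex_eq_iff)+

lemma sphere_part_scaleR: "sphere_part (t *\<^sub>R w) = t *\<^sub>R sphere_part w"
  by (cases w) (simp add: sphere_part_def)

lemma time_part_null_vec: "time_part (null_vec y) = cis (fst y)"
  by (cases y) (simp add: time_part_def null_vec_def complex_eq_iff)

lemma sphere_part_null_vec: "sphere_part (null_vec y) = snd y"
  by (cases y) (simp add: sphere_part_def null_vec_def)

lemma r2n_eqI:
  "time_part w = time_part w' \<Longrightarrow> sphere_part w = sphere_part w' \<Longrightarrow> w = w'"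
  by (cases w; cases w') (simp add: time_part_def sphere_part_def)

lemma norm_r2n: "(norm w)\<^sup>2 = (norm (time_part w))\<^sup>2 + (norm (sphere_part w))\<^sup>2"
  by (cases w) (simp add: time_part_def sphere_part_def norm_Pair cmod_power2)

lemma q2n_parts: "q2n w = (norm (sphere_part w))\<^sup>2 - (norm (time_part w))\<^sup>2"
  by (cases w) (simp add: time_part_def sphere_part_def q2n_eq cmod_power2)

lemma norm_time_part_le: "norm (time_part w) \<le> norm w"
  by (rule power2_le_imp_le) (simp_all add: norm_r2n)

lemma continuous_on_time_part [continuous_intros]:
  "continuous_on A f \<Longrightarrow> continuous_on A (\<lambda>y. time_part (f y))"
  unfolding time_part_def case_prod_unfold Complex_eq by (intro continuous_intros)

lemma continuous_on_sphere_part [continuous_intros]: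
  "continuous_on A f \<Longrightarrow> continuous_on A (\<lambda>y. sphere_part (f y))"
  unfolding sphere_part_def case_prod_unfold by (intro continuous_intros)

lemma continuous_on_null_vec [continuous_intros]:
  fixes f :: "'a::t2_space \<Rightarrow> real \<times> (real ^ 'n::finite)"
  assumes "continuous_on A f"
  shows "continuous_on A (\<lambda>y. null_vec (f y))"
proof -
  have "continuous_on A (\<lambda>y. (cos (fst (f y)), sin (fst (f y)), snd (f y)))"
    using assms by (intro continuous_on_Pair continuous_on_cos continuous_on_sin continuous_on_fst continuous_on_snd)
  then show ?thesis by (simp add: null_vec_def case_prod_unfold)
qed

lemma Ein_cover_iff: "y \<in> Ein_cover \<longleftrightarrow> norm (snd y) = 1"
  by (cases y) (simp add: Ein_cover_def)

lemma q2n_null_vec: "y \<in> Ein_cover \<Longrightarrow> q2n (null_vec y) = 0"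
  by (simp add: q2n_parts time_part_null_vec sphere_part_null_vec Ein_cover_iff)

lemma norm_null_vec: "y \<in> Ein_cover \<Longrightarrow> (norm (null_vec y))\<^sup>2 = 2"
  by (simp add: norm_r2n time_part_null_vec sphere_part_null_vec Ein_cover_iff)

lemma norm_parts_of_image:
  assumes "g \<in> O2n" "y \<in> Ein_cover"
  shows "norm (sphere_part (blinfun_apply g (null_vec y))) = norm (time_part (blinfun_apply g (null_vec y)))"
  using O2n_q2n[OF assms(1), of "null_vec y"] q2n_null_vec[OF assms(2)]
  by (simp add: q2n_parts power2_eq_iff_nonneg)

text \<open>
  On isotropic vectors the two parts have equal norm, so this follows from the lower bound for the injective linear map \<open>g\<close>.
\<close>

lemma time_part_bounded_below:
  assumes g: "g \<in> O2n"
  obtains B where "B > 0" "\<And>y. y \<in> Ein_cover \<Longrightarrow> B \<le> norm (time_part (blinfun_apply g (null_vec y)))"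
proof -
  have "linear (blinfun_apply g)"
    by (simp add: blinfun.bounded_linear_right bounded_linear.linear)
  then obtain B where B: "B > 0" "\<And>w. B * norm w \<le> norm (blinfun_apply g w)"
    using linear_inj_bounded_below_pos[OF _ O2n_inj[OF g]] by blast
  show ?thesis
  proof
    fix y :: "real \<times> (real ^ 'a)" assume y: "y \<in> Ein_cover"
    have "B\<^sup>2 * 2 = (B * norm (null_vec y))\<^sup>2"
      by (simp add: power_mult_distrib norm_null_vec[OF y])
    also have "\<dots> \<le> (norm (blinfun_apply g (null_vec y)))\<^sup>2"
      using B by (intro power_mono) auto
    also have "\<dots> = 2 * (norm (time_part (blinfun_apply g (null_vec y))))\<^sup>2"
      by (simp add: norm_r2n norm_parts_of_image[OF g y])
    finally show "B \<le> norm (time_part (blinfun_apply g (null_vec y)))"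
      by (intro power2_le_imp_le[OF _ norm_ge_zero]) simp
  qed (rule B)
qed

lemma time_part_nonzero:
  "g \<in> O2n \<Longrightarrow> y \<in> Ein_cover \<Longrightarrow> time_part (blinfun_apply g (null_vec y)) \<noteq> 0"
  using time_part_bounded_below[of g] by (metis norm_zero not_le)

definition shift :: "int \<Rightarrow> real \<times> 'a \<Rightarrow> real \<times> 'a" where
  "shift k = (\<lambda>(\<theta>, x). (\<theta> + 2 * pi * of_int k, x))"

lemma shift_simps [simp]:
  "fst (shift k y) = fst y + 2 * pi * of_int k" "snd (shift k y) = snd y"
  "shift 0 y = y" "shift k (shift l y) = shift (k + l) y"
  by (cases y; simp add: shift_def algebra_simps)+

lemma shift_in_cover [simp]: "shift k y \<in> Ein_cover \<longleftrightarrow> y \<in> Ein_cover"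
  by (simp add: Ein_cover_iff)

lemma shift_inject [simp]: "shift k y = shift l y \<longleftrightarrow> k = l"
  by (cases y) (simp add: shift_def)

lemma null_vec_shift_int: "null_vec (shift k y) = null_vec y"
proof -
  have "cos (\<theta> + 2 * pi * of_int k) = cos \<theta>" "sin (\<theta> + 2 * pi * of_int k) = sin \<theta>" for \<theta> :: real
    by (simp_all add: cos_add sin_add cos_int_2pin sin_int_2pin)
  then show ?thesis by (cases y) (simp add: null_vec_def shift_def)
qed

text \<open>
  A continuous choice \<open>a\<close> of the amount by which \<open>g\<close> changes the angle coordinate. Because \<open>a\<close> descends to
  \<open>Ein\<close>, the lift that it defines commutes with the deck transformations.
\<close>

definition angle_change :: "('n::finite r2n \<Rightarrow>\<^sub>L 'n r2n) \<Rightarrow> (real \<times> (real ^ 'n) \<Rightarrow> real) \<Rightarrow> bool" where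
  "angle_change g a \<longleftrightarrow> continuous_on Ein_cover a \<and>
     (\<forall>y\<in>Ein_cover. a (shift 1 y) = a y) \<and>
     (\<forall>y\<in>Ein_cover. cis (fst y + a y) = sgn (time_part (blinfun_apply g (null_vec y))))"

text \<open>
  The ratio of the time parts of \<open>h\<close> and \<open>g\<close> stays in the right half-plane, where the principal argument is
  continuous; adding it to \<open>a\<close> corrects the angle from \<open>g\<close> to \<open>h\<close>.
\<close>

lemma angle_change_near:
  fixes g h :: "'n::finite r2n \<Rightarrow>\<^sub>L 'n r2n"
  assumes g: "g \<in> O2n" and a: "angle_change g a"
    and near: "\<And>y. y \<in> Ein_cover \<Longrightarrow>
      norm (time_part (blinfun_apply h (null_vec y)) - time_part (blinfun_apply g (null_vec y)))
        < norm (time_part (blinfun_apply g (null_vec y)))"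
  shows "\<exists>a'. angle_change h a'"
proof -
  define z where "z = (\<lambda>(k :: 'n r2n \<Rightarrow>\<^sub>L 'n r2n) y. time_part (blinfun_apply k (null_vec y)))"
  define r where "r = (\<lambda>y. z h y / z g y)"
  have nz: "z g y \<noteq> 0" if "y \<in> Ein_cover" for y
    using time_part_nonzero[OF g that] by (simp add: z_def)
  have contz: "continuous_on Ein_cover (z k)" for k
    unfolding z_def by (intro continuous_intros)
  have Re: "Re (r y) > 0" if "y \<in> Ein_cover" for y
  proof -
    have "r y - 1 = (z h y - z g y) / z g y" using nz[OF that] by (simp add: r_def diff_divide_distrib)
    then have "norm (r y - 1) < 1" using near[OF that] nz[OF that] by (simp add: norm_divide z_def)
    then show ?thesis using abs_Re_le_cmod[of "r y - 1"] by simp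
  qed
  have "angle_change h (\<lambda>y. a y + Arg (r y))"
    unfolding angle_change_def
  proof (intro conjI)
    have "continuous_on Ein_cover (\<lambda>y. Arg (r y))"
    proof (rule continuous_on_Arg')
      show "continuous_on Ein_cover r"
        unfolding r_def using contz nz by (intro continuous_on_divide) auto
      show "r y \<notin> \<real>\<^sub>\<le>\<^sub>0" if "y \<in> Ein_cover" for y
        using Re[OF that] by (auto simp: complex_nonpos_Reals_iff)
    qed
    then show "continuous_on Ein_cover (\<lambda>y. a y + Arg (r y))"
      using a by (intro continuous_on_add) (auto simp: angle_change_def)
    show "\<forall>y\<in>Ein_cover. a (shift 1 y) + Arg (r (shift 1 y)) = a y + Arg (r y)"
      using a by (simp add: angle_change_def r_def z_def null_vec_shift_int)
    show "\<forall>y\<in>Ein_cover. cis (fst y + (a y + Arg (r y))) = sgn (time_part (blinfun_apply h (null_vec y)))"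
    proof
      fix y :: "real \<times> (real ^ 'n)" assume y: "y \<in> Ein_cover"
      have "cis (fst y + (a y + Arg (r y))) = cis (fst y + a y) * cis (Arg (r y))"
        by (simp add: cis_mult add.assoc)
      also have "cis (fst y + a y) = sgn (z g y)" using a y by (auto simp: angle_change_def z_def)
      also have "cis (Arg (r y)) = sgn (r y)" using Re[OF y] by (intro cis_Arg) auto
      also have "sgn (z g y) * sgn (r y) = sgn (z h y)"
        using nz[OF y] sgn_mult[of "z g y" "r y"] by (simp add: r_def)
      finally show "cis (fst y + (a y + Arg (r y))) = sgn (time_part (blinfun_apply h (null_vec y)))"
        by (simp add: z_def)
    qed
  qed
  then show ?thesis by blast
qed

lemma angle_change_id: "angle_change id_blinfun (\<lambda>_. 0)"
  by (auto simp: angle_change_def time_part_null_vec)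

lemma angle_change_locally_constant:
  assumes g: "g \<in> O2n"
  shows "\<forall>\<^sub>F h in at g within O2n. (\<exists>a. angle_change g a) = (\<exists>a. angle_change h a)"
proof -
  obtain B where B: "B > 0" "\<And>y. y \<in> Ein_cover \<Longrightarrow> B \<le> norm (time_part (blinfun_apply g (null_vec y)))"
    using time_part_bounded_below[OF g] by blast
  \<comment> \<open>Null vectors have norm at most 2, so the time parts of the images differ by less than B / 2.\<close>
  have "\<forall>\<^sub>F h in at g within O2n. h \<in> O2n \<and> dist h g < B / 4"
    using B(1) by (auto simp: eventually_at intro!: exI[of _ "B / 4"])
  then show ?thesis
  proof eventually_elim
    case (elim h)
    have d: "norm (time_part (blinfun_apply h (null_vec y)) - time_part (blinfun_apply g (null_vec y))) < B / 2"
      if y: "y \<in> Ein_cover" for y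
    proof -
      have "norm (time_part (blinfun_apply h (null_vec y)) - time_part (blinfun_apply g (null_vec y)))
          \<le> norm (blinfun_apply (h - g) (null_vec y))"
        using norm_time_part_le[of "blinfun_apply (h - g) (null_vec y)"]
        by (simp add: time_part_linear blinfun.diff_left)
      also have "\<dots> \<le> norm (h - g) * norm (null_vec y)" by (rule norm_blinfun)
      also have "norm (null_vec y) \<le> 2"
        using norm_null_vec[OF y] power2_le_imp_le[of "norm (null_vec y)" 2] by simp
      then have "norm (h - g) * norm (null_vec y) \<le> norm (h - g) * 2" by (intro mult_left_mono) auto
      also have "\<dots> < B / 2" using elim by (simp add: dist_norm)
      finally show ?thesis .
    qed
    have "norm (time_part (blinfun_apply h (null_vec y)) - time_part (blinfun_apply g (null_vec y)))
        < norm (time_part (blinfun_apply g (null_vec y)))" if "y \<in> Ein_cover" for y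
      using d[OF that] B(1) B(2)[OF that] by linarith
    moreover have "norm (time_part (blinfun_apply g (null_vec y)) - time_part (blinfun_apply h (null_vec y)))
        < norm (time_part (blinfun_apply h (null_vec y)))" if "y \<in> Ein_cover" for y
      using d[OF that] B(2)[OF that]
        norm_triangle_ineq2[of "time_part (blinfun_apply g (null_vec y))" "time_part (blinfun_apply h (null_vec y))"]
      by (simp add: norm_minus_commute)
    ultimately show ?case using angle_change_near g elim by blast
  qed
qed

text \<open>
  The existence of \<open>a\<close> is a locally constant property of the isometry, and it holds for the identity. A lifting criterion
  for simply connected spaces would leave out \<open>n = 2\<close>, where \<open>Ein_cover\<close> is an annulus.
\<close>

lemma SO0_angle_change:
  assumes "g \<in> carrier SO0"
  obtains a where "angle_change g a"
proof -
  let ?C = "connected_component_set O2n id_blinfun"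
  have "(\<exists>a. angle_change (id_blinfun :: 'a r2n \<Rightarrow>\<^sub>L 'a r2n) a) = (\<exists>a. angle_change g a)"
  proof (rule connected_local_const[of ?C])
    show "\<forall>h\<in>?C. \<forall>\<^sub>F k in at h within ?C. (\<exists>a. angle_change h a) = (\<exists>a. angle_change k a)"
    proof
      fix h assume "h \<in> ?C"
      then have "h \<in> O2n" using connected_component_subset by blast
      then show "\<forall>\<^sub>F k in at h within ?C. (\<exists>a. angle_change h a) = (\<exists>a. angle_change k a)"
        using angle_change_locally_constant filter_leD[OF at_le[OF connected_component_subset]] by blast
    qed
    show "id_blinfun \<in> ?C" "g \<in> ?C" using assms SO0_id by (simp_all add: carrier_SO0)
  qed simp
  then show ?thesis using angle_change_id that by blast
qed

section \<open>Lifts to the cyclic covering\<close>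

text \<open>
  Lifts as continuous self-maps, so that they compose as plain functions. Uniqueness up to the deck group already
  holds for them, and is used to construct the inverse of a lift (\<open>SO0_lift_exists\<close>).
\<close>

definition weak_lift ::
  "('n::finite r2n \<Rightarrow>\<^sub>L 'n r2n) \<Rightarrow> (real \<times> (real ^ 'n) \<Rightarrow> real \<times> (real ^ 'n)) \<Rightarrow> bool" where
  "weak_lift g F \<longleftrightarrow> continuous_on Ein_cover F \<and> F ` Ein_cover \<subseteq> Ein_cover \<and>
     (\<forall>y\<in>Ein_cover. ein_proj (F y) = blinfun_apply g ` ein_proj y)"

lemma ein_proj_eq: "ein_proj y = ray (null_vec y)"
  by (cases y) (simp add: ein_proj_def null_vec_def)

lemma ray_image: "blinfun_apply g ` ray w = ray (blinfun_apply g w)"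
  by (auto simp: ray_def blinfun.scaleR_right image_iff) (metis blinfun.scaleR_right)

lemma ray_eq_iff: "ray w = ray w' \<longleftrightarrow> (\<exists>s>0. w = s *\<^sub>R w')"
proof
  assume "ray w = ray w'"
  moreover have "w \<in> ray w" unfolding ray_def by (auto intro: exI[of _ 1])
  ultimately show "\<exists>s>0. w = s *\<^sub>R w'" by (auto simp: ray_def)
next
  assume "\<exists>s>0. w = s *\<^sub>R w'"
  then obtain s where s: "s > 0" "w = s *\<^sub>R w'" by blast
  have "t *\<^sub>R w' \<in> ray (s *\<^sub>R w')" if "t > 0" for t
    unfolding ray_def using that s(1) by (auto intro!: exI[of _ "t / s"])
  moreover have "t *\<^sub>R (s *\<^sub>R w') \<in> ray w'" if "t > 0" for t
    unfolding ray_def using that s(1) by (auto intro!: exI[of _ "t * s"])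
  ultimately show "ray w = ray w'" unfolding s(2) by (auto simp: ray_def)
qed

lemma ein_proj_image_iff:
  "ein_proj y' = blinfun_apply g ` ein_proj y \<longleftrightarrow>
    (\<exists>s>0. blinfun_apply g (null_vec y) = s *\<^sub>R null_vec y')"
  unfolding ein_proj_eq ray_image by (metis ray_eq_iff)

text \<open>
  The last component of \<open>null_vec\<close> is a unit vector, which fixes the scale.
\<close>

lemma null_vec_proportional:
  assumes y: "y \<in> Ein_cover" "y' \<in> Ein_cover" and st: "s > 0" "t > 0"
    and eq: "s *\<^sub>R null_vec y = t *\<^sub>R null_vec y'"
  obtains k where "y' = shift k y"
proof -
  have "s *\<^sub>R snd y = t *\<^sub>R snd y'"
    using arg_cong[OF eq, of sphere_part] by (simp add: sphere_part_scaleR sphere_part_null_vec)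
  moreover from this have "norm (s *\<^sub>R snd y) = norm (t *\<^sub>R snd y')" by simp
  then have "s = t" using y st by (simp add: Ein_cover_iff)
  ultimately have x: "snd y = snd y'" using st by simp
  have "cis (fst y) = cis (fst y')"
    using arg_cong[OF eq, of time_part] st \<open>s = t\<close> by (simp add: time_part_linear time_part_null_vec)
  then have "sin (fst y') = sin (fst y) \<and> cos (fst y') = cos (fst y)"
    by (simp add: complex_eq_iff)
  then obtain k :: int where "fst y' = fst y + 2 * pi * of_int k"
    unfolding sin_cos_eq_iff by (auto simp: algebra_simps)
  then show ?thesis using x that[of k] by (simp add: prod_eq_iff)
qed

lemma connected_Ein_cover:
  assumes "CARD('n::finite) \<ge> 2"
  shows "connected (Ein_cover :: (real \<times> (real ^ 'n)) set)"
  unfolding Ein_cover_def using assms by (intro connected_Times connected_sphere) auto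

text \<open>
  Pointwise the two lifts differ by an integer multiple of \<open>2 \<pi>\<close>; the multiple depends continuously on the
  point of a connected space.
\<close>

lemma weak_lift_unique:
  fixes F1 F2 :: "real \<times> (real ^ 'n::finite) \<Rightarrow> real \<times> (real ^ 'n)"
  assumes n: "CARD('n) \<ge> 2" and F1: "weak_lift g F1" and F2: "weak_lift g F2"
  obtains k where "\<And>y. y \<in> Ein_cover \<Longrightarrow> F2 y = shift k (F1 y)"
proof -
  have ex: "\<exists>k. F2 y = shift k (F1 y)" if y: "y \<in> Ein_cover" for y
  proof -
    have "F1 y \<in> Ein_cover" "F2 y \<in> Ein_cover" using y F1 F2 by (auto simp: weak_lift_def)
    moreover obtain s t where "s > 0" "t > 0"
      "blinfun_apply g (null_vec y) = s *\<^sub>R null_vec (F1 y)"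
      "blinfun_apply g (null_vec y) = t *\<^sub>R null_vec (F2 y)"
      using y F1 F2 unfolding weak_lift_def ein_proj_image_iff by blast
    ultimately show ?thesis by (metis null_vec_proportional)
  qed
  then obtain k where k: "\<And>y. y \<in> Ein_cover \<Longrightarrow> F2 y = shift (k y) (F1 y)" by metis
  define h where "h = (\<lambda>y. (fst (F2 y) - fst (F1 y)) / (2 * pi))"
  have h: "h y = of_int (k y)" if "y \<in> Ein_cover" for y using k[OF that] by (simp add: h_def)
  have "h constant_on Ein_cover"
  proof (rule continuous_discrete_range_constant[OF connected_Ein_cover[OF n]])
    show "continuous_on Ein_cover h"
      unfolding h_def using F1 F2 by (intro continuous_intros) (auto simp: weak_lift_def)
    fix y assume y: "y \<in> (Ein_cover :: (real \<times> (real ^ 'n)) set)"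
    \<comment> \<open>Distinct values of h are distinct integers.\<close>
    show "\<exists>e>0. \<forall>z. z \<in> Ein_cover \<and> h z \<noteq> h y \<longrightarrow> e \<le> norm (h z - h y)"
    proof (intro exI[of _ 1] conjI allI impI)
      fix z assume "z \<in> Ein_cover \<and> h z \<noteq> h y"
      then have "h z - h y = of_int (k z - k y)" "k z - k y \<noteq> 0" using h[OF y] h[of z] by auto
      then show "1 \<le> norm (h z - h y)"
        unfolding real_norm_def by linarith
    qed simp
  qed
  then obtain c where c: "\<And>y. y \<in> Ein_cover \<Longrightarrow> h y = c" by (auto simp: constant_on_def)
  show ?thesis
  proof (cases "\<exists>y. y \<in> (Ein_cover :: (real \<times> (real ^ 'n)) set)")
    case True
    then obtain y0 where y0: "y0 \<in> (Ein_cover :: (real \<times> (real ^ 'n)) set)" by blast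
    have "k y = k y0" if "y \<in> Ein_cover" for y using h[OF that] h[OF y0] c[OF that] c[OF y0] by simp
    then show ?thesis using k that by metis
  qed (use that in blast)
qed

lemma weak_lift_compose:
  assumes "weak_lift g F" "weak_lift h H"
  shows "weak_lift (g o\<^sub>L h) (\<lambda>y. F (H y))"
proof -
  have "continuous_on Ein_cover (\<lambda>y. F (H y))"
    using assms by (intro continuous_on_compose2[of Ein_cover F Ein_cover H]) (auto simp: weak_lift_def)
  moreover have "ein_proj (F (H y)) = blinfun_apply (g o\<^sub>L h) ` ein_proj y" if "y \<in> Ein_cover" for y
  proof -
    have "ein_proj (F (H y)) = blinfun_apply g ` ein_proj (H y)"
      using assms that by (auto simp: weak_lift_def)
    also have "ein_proj (H y) = blinfun_apply h ` ein_proj y" using assms that by (auto simp: weak_lift_def)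
    finally show ?thesis by (simp add: image_image)
  qed
  moreover have "F (H y) \<in> Ein_cover" if "y \<in> Ein_cover" for y
    using assms that unfolding weak_lift_def image_subset_iff by blast
  ultimately show ?thesis unfolding weak_lift_def image_subset_iff by blast
qed

lemma weak_lift_shift_id: "weak_lift id_blinfun (shift k)"
proof -
  have "continuous_on Ein_cover (shift k :: real \<times> (real ^ 'a) \<Rightarrow> _)"
    unfolding shift_def case_prod_unfold by (intro continuous_intros)
  moreover have "ein_proj (shift k y) = ein_proj y" for y :: "real \<times> (real ^ 'a)"
    by (simp add: ein_proj_eq null_vec_shift_int)
  ultimately show ?thesis by (auto simp: weak_lift_def)
qed

lemma weak_lift_shift:
  assumes "weak_lift g F"
  shows "weak_lift g (\<lambda>y. shift k (F y))"
proof -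
  have "id_blinfun o\<^sub>L g = g" by (rule blinfun_eqI) simp
  then show ?thesis using weak_lift_compose[OF weak_lift_shift_id assms, of k] by simp
qed

lemma SO0_weak_lift_equivariant:
  assumes g: "g \<in> carrier SO0"
  obtains F where "weak_lift g F" "\<And>y. y \<in> Ein_cover \<Longrightarrow> F (shift 1 y) = shift 1 (F y)"
proof -
  obtain a where a: "angle_change g a" using SO0_angle_change[OF g] by blast
  have gO: "g \<in> O2n" by (rule SO0_subset_O2n[OF g])
  define p where "p = (\<lambda>y. sphere_part (blinfun_apply g (null_vec y)))"
  define z where "z = (\<lambda>y. time_part (blinfun_apply g (null_vec y)))"
  define F where "F = (\<lambda>y. (fst y + a y, p y /\<^sub>R norm (p y)))"
  have norm: "norm (p y) = norm (z y)" and nz: "z y \<noteq> 0" "p y \<noteq> 0" if "y \<in> Ein_cover" for y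
    using norm_parts_of_image[OF gO that] time_part_nonzero[OF gO that] by (auto simp: p_def z_def)
  have contp: "continuous_on Ein_cover p" unfolding p_def by (intro continuous_intros)
  have "weak_lift g F"
    unfolding weak_lift_def
  proof (intro conjI ballI)
    show "continuous_on Ein_cover F"
      unfolding F_def using a contp nz
      by (intro continuous_intros) (auto simp: angle_change_def)
    show "F ` Ein_cover \<subseteq> Ein_cover" using nz by (auto simp: F_def Ein_cover_iff)
    fix y :: "real \<times> (real ^ 'a)" assume y: "y \<in> Ein_cover"
    have "blinfun_apply g (null_vec y) = norm (z y) *\<^sub>R null_vec (F y)"
    proof (rule r2n_eqI)
      have "cis (fst y + a y) = sgn (z y)" using a y by (auto simp: angle_change_def z_def)
      then show "time_part (blinfun_apply g (null_vec y)) = time_part (norm (z y) *\<^sub>R null_vec (F y))"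
        using nz[OF y] by (simp add: time_part_linear time_part_null_vec F_def sgn_div_norm) (simp add: z_def)
      show "sphere_part (blinfun_apply g (null_vec y)) = sphere_part (norm (z y) *\<^sub>R null_vec (F y))"
        using nz[OF y] norm[OF y]
        by (simp add: sphere_part_scaleR sphere_part_null_vec F_def) (simp add: p_def)
    qed
    then show "ein_proj (F y) = blinfun_apply g ` ein_proj y"
      unfolding ein_proj_image_iff using nz[OF y] by (intro exI[of _ "norm (z y)"]) simp
  qed
  moreover have "F (shift 1 y) = shift 1 (F y)" if "y \<in> Ein_cover" for y
  proof -
    have "a (shift 1 y) = a y"
      using a that by (simp add: angle_change_def)
    then show ?thesis by (simp add: F_def p_def null_vec_shift_int prod_eq_iff)
  qed
  ultimately show ?thesis by (rule that)
qed

text \<open>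
  The property holds for one lift by construction and passes to all others, which differ from it by a deck
  transformation.
\<close>

lemma weak_lift_equivariant:
  fixes F :: "real \<times> (real ^ 'n::finite) \<Rightarrow> real \<times> (real ^ 'n)"
  assumes n: "CARD('n) \<ge> 2" and g: "g \<in> carrier SO0" and F: "weak_lift g F" and y: "y \<in> Ein_cover"
  shows "F (shift k y) = shift k (F y)"
proof -
  obtain F0 where F0: "weak_lift g F0" "\<And>y. y \<in> Ein_cover \<Longrightarrow> F0 (shift 1 y) = shift 1 (F0 y)"
    using SO0_weak_lift_equivariant[OF g] by blast
  obtain m where m: "\<And>y. y \<in> Ein_cover \<Longrightarrow> F y = shift m (F0 y)"
    using weak_lift_unique[OF n F0(1) F] by blast
  have one: "F (shift 1 y) = shift 1 (F y)" if "y \<in> Ein_cover" for y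
    using m[OF that] m[of "shift 1 y"] F0(2)[OF that] that by (simp add: add.commute)
  show ?thesis
  proof (induction k rule: int_induct[where k = 0])
    case base
    show ?case by simp
  next
    case (step1 k)
    then show ?case using one[of "shift k y"] y by (simp add: add.commute)
  next
    case (step2 k)
    then have "shift 1 (F (shift (k - 1) y)) = shift k (F y)"
      using one[of "shift (k - 1) y"] y by simp
    then have "shift (- 1) (shift 1 (F (shift (k - 1) y))) = shift (- 1) (shift k (F y))" by (rule arg_cong)
    then show ?case by simp
  qed
qed

lemma lift_of_iff_weak_lift:
  "lift_of g F \<longleftrightarrow> F \<in> extensional Ein_cover \<and> weak_lift g F \<and> (\<exists>G. homeomorphism Ein_cover Ein_cover F G)"
  unfolding lift_of_def weak_lift_def homeomorphism_def by blast

lemma weak_lift_inverse: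
  assumes F: "weak_lift g F" and FG: "homeomorphism Ein_cover Ein_cover F G"
    and h: "h o\<^sub>L g = id_blinfun"
  shows "weak_lift h G"
  unfolding weak_lift_def
proof (intro conjI ballI)
  show "continuous_on Ein_cover G" "G ` Ein_cover \<subseteq> Ein_cover"
    using FG by (auto simp: homeomorphism_def)
  fix y :: "real \<times> (real ^ 'a)" assume y: "y \<in> Ein_cover"
  have hg: "blinfun_apply h (blinfun_apply g w) = w" for w
    using arg_cong[OF h, of "\<lambda>k. blinfun_apply k w"] by simp
  have "G y \<in> Ein_cover" "F (G y) = y" using FG y by (auto simp: homeomorphism_def)
  then have "ein_proj y = blinfun_apply g ` ein_proj (G y)" using F unfolding weak_lift_def by metis
  then show "ein_proj (G y) = blinfun_apply h ` ein_proj y" by (simp add: image_image hg)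
qed

lemma lift_of_restrict_homeomorphism:
  assumes "weak_lift g F" "homeomorphism Ein_cover Ein_cover F G"
  shows "lift_of g (restrict F Ein_cover)"
proof -
  have "homeomorphism Ein_cover Ein_cover (restrict F Ein_cover) G"
    by (rule homeomorphism_cong[OF assms(2)]) auto
  moreover have "weak_lift g (restrict F Ein_cover)"
    using assms(1) by (auto simp: weak_lift_def cong: continuous_on_cong)
  ultimately show ?thesis unfolding lift_of_iff_weak_lift by auto
qed

text \<open>
  Lifts \<open>F\<close> of \<open>g\<close> and \<open>H\<close> of the inverse compose to lifts of the identity, which are deck
  transformations. Correcting \<open>H\<close> by one of them makes it an inverse of \<open>F\<close>.
\<close>

lemma SO0_lift_exists:
  fixes g :: "'n::finite r2n \<Rightarrow>\<^sub>L 'n r2n"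
  assumes n: "CARD('n) \<ge> 2" and g: "g \<in> carrier SO0"
  obtains F where "lift_of g F"
proof -
  obtain h where h: "h \<in> carrier SO0" "h o\<^sub>L g = id_blinfun" "g o\<^sub>L h = id_blinfun"
    using SO0_inverse[OF g] by blast
  obtain F where F: "weak_lift g F" using SO0_weak_lift_equivariant[OF g] by blast
  obtain H where H: "weak_lift h H" using SO0_weak_lift_equivariant[OF h(1)] by blast
  obtain k where k: "\<And>y. y \<in> Ein_cover \<Longrightarrow> H (F y) = shift k y"
    using weak_lift_unique[OF n weak_lift_shift_id[of 0], of "\<lambda>y. H (F y)"] weak_lift_compose[OF H F]
    by (auto simp: h)
  define G where "G = (\<lambda>y. shift (- k) (H y))"
  have G: "weak_lift h G" unfolding G_def by (rule weak_lift_shift[OF H])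
  have GF: "G (F y) = y" if "y \<in> Ein_cover" for y using k[OF that] by (simp add: G_def)
  obtain m where m: "\<And>y. y \<in> Ein_cover \<Longrightarrow> F (G y) = shift m y"
    using weak_lift_unique[OF n weak_lift_shift_id[of 0], of "\<lambda>y. F (G y)"] weak_lift_compose[OF F G]
    by (auto simp: h)
  have FG: "F (G y) = y" if y: "y \<in> Ein_cover" for y
  proof -
    have Fy: "F y \<in> Ein_cover" using F y by (auto simp: weak_lift_def)
    have "shift m (F y) = shift 0 (F y)" using m[OF Fy] GF[OF y] by simp
    then have "m = 0" by (simp only: shift_inject)
    then show ?thesis using m[OF y] by simp
  qed
  have "homeomorphism Ein_cover Ein_cover F G"
    using F G GF FG by (intro homeomorphismI) (auto simp: weak_lift_def)
  then have "lift_of g (restrict F Ein_cover)" by (rule lift_of_restrict_homeomorphism[OF F])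
  then show ?thesis by (rule that)
qed

section \<open>Lifts preserve the chronological order\<close>

definition chron :: "real \<times> (real ^ 'n::finite) \<Rightarrow> real \<times> (real ^ 'n) \<Rightarrow> bool" where
  "chron p q \<longleftrightarrow> sdist (snd p) (snd q) < fst q - fst p"

text \<open>
  Neither point lies in the chronological past of the other; lightlike related points are included.
\<close>

definition acausal :: "real \<times> (real ^ 'n::finite) \<Rightarrow> real \<times> (real ^ 'n) \<Rightarrow> bool" where
  "acausal p q \<longleftrightarrow> \<bar>fst q - fst p\<bar> \<le> sdist (snd p) (snd q)"

lemma chron_or_acausal: "chron p q \<or> chron q p \<or> acausal p q"
  unfolding chron_def acausal_def by (auto simp: sdist_commute abs_le_iff not_less)

lemma q2n_null_vec_sum:
  assumes "p \<in> Ein_cover" "q \<in> Ein_cover"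
  shows "q2n (s *\<^sub>R null_vec p + t *\<^sub>R null_vec q) = 2 * s * t * (snd p \<bullet> snd q - cos (fst q - fst p))"
proof -
  obtain \<theta> x \<eta> y where eq: "p = (\<theta>, x)" "q = (\<eta>, y)" by (cases p; cases q)
  have "(norm (s *\<^sub>R x + t *\<^sub>R y))\<^sup>2 = s\<^sup>2 + t\<^sup>2 + 2 * s * t * (x \<bullet> y)"
    using assms unfolding power2_norm_eq_inner
    by (simp add: eq Ein_cover_iff norm_eq_1 inner_add_left inner_add_right inner_commute[of y x] power2_eq_square algebra_simps)
  moreover have "(s * cos \<theta> + t * cos \<eta>)\<^sup>2 + (s * sin \<theta> + t * sin \<eta>)\<^sup>2
      = s\<^sup>2 * ((cos \<theta>)\<^sup>2 + (sin \<theta>)\<^sup>2) + t\<^sup>2 * ((cos \<eta>)\<^sup>2 + (sin \<eta>)\<^sup>2) + 2 * s * t * cos (\<eta> - \<theta>)"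
    unfolding cos_diff by algebra
  then have "(s * cos \<theta> + t * cos \<eta>)\<^sup>2 + (s * sin \<theta> + t * sin \<eta>)\<^sup>2 = s\<^sup>2 + t\<^sup>2 + 2 * s * t * cos (\<eta> - \<theta>)"
    by simp
  ultimately show ?thesis
    by (simp add: eq null_vec_def q2n_eq algebra_simps)
qed

text \<open>
  Both gaps are scalar products of null vectors, obtained by polarising the form. The isometry \<open>g\<close> takes the
  representatives of the two rays to positive multiples of the representatives of the image rays, and \<open>1 / c\<close> is the
  product of these multiples.
\<close>

lemma inner_gap_scaled:
  assumes g: "g \<in> O2n" and F: "weak_lift g F" and p: "p \<in> Ein_cover" and q: "q \<in> Ein_cover"
  obtains c where "c > 0"
    "snd (F p) \<bullet> snd (F q) - cos (fst (F q) - fst (F p)) = c * (snd p \<bullet> snd q - cos (fst q - fst p))"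
proof -
  obtain s where s: "s > 0" "blinfun_apply g (null_vec p) = s *\<^sub>R null_vec (F p)"
    using F p unfolding weak_lift_def ein_proj_image_iff by blast
  obtain t where t: "t > 0" "blinfun_apply g (null_vec q) = t *\<^sub>R null_vec (F q)"
    using F q unfolding weak_lift_def ein_proj_image_iff by blast
  have FS: "F p \<in> Ein_cover" "F q \<in> Ein_cover" using F p q by (auto simp: weak_lift_def)
  have "q2n (s *\<^sub>R null_vec (F p) + t *\<^sub>R null_vec (F q)) = q2n (null_vec p + null_vec q)"
    using O2n_q2n[OF g, of "null_vec p + null_vec q"] by (simp add: blinfun.add_right s t)
  then have "s * t * (snd (F p) \<bullet> snd (F q) - cos (fst (F q) - fst (F p))) = snd p \<bullet> snd q - cos (fst q - fst p)"
    using q2n_null_vec_sum[OF FS, of s t] q2n_null_vec_sum[OF p q, of 1 1] by simp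
  then show ?thesis
    using s t by (intro that[of "1 / (s * t)"]) (auto simp: field_simps)
qed

lemma connected_avoiding_pi:
  fixes h :: "'a::topological_space \<Rightarrow> real"
  assumes A: "connected A" and h: "continuous_on A h" and a: "a \<in> A" "\<bar>h a\<bar> < pi"
    and avoid: "\<And>y. y \<in> A \<Longrightarrow> \<bar>h y\<bar> \<noteq> pi" and y: "y \<in> A"
  shows "\<bar>h y\<bar> < pi"
  using connected_real_sign[of "\<lambda>y. \<bar>h y\<bar> - pi" A] a avoid y
  by (force intro!: connected_continuous_image continuous_intros A h)

lemma inner_eq_1_imp_eq:
  assumes "norm x = 1" "norm y = 1" "1 \<le> x \<bullet> y"
  shows "x = y"
proof -
  have "(norm (x - y))\<^sup>2 = 2 - 2 * (x \<bullet> y)"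
    unfolding power2_norm_eq_inner using assms
    by (simp add: norm_eq_1 inner_diff_left inner_diff_right inner_commute[of y x])
  then have "(norm (x - y))\<^sup>2 \<le> 0" using assms by simp
  then show ?thesis by simp
qed

text \<open>
  If the angles of the image points differed by \<open>\<pi>\<close>, the gap of the images would be
  \<open>X \<bullet> X' + 1 \<ge> 0\<close>, whereas it has the same sign as the negative gap of \<open>p\<close> and \<open>q\<close>.
\<close>

lemma lift_never_antipodal:
  assumes g: "g \<in> O2n" and F: "weak_lift g F" and p: "p \<in> Ein_cover" and q: "q \<in> Ein_cover"
    and gap: "snd p \<bullet> snd q < cos (fst q - fst p)"
  shows "\<bar>fst (F q) - fst (F p)\<bar> \<noteq> pi"
proof
  assume pi: "\<bar>fst (F q) - fst (F p)\<bar> = pi"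
  have "cos (fst (F q) - fst (F p)) = cos \<bar>fst (F q) - fst (F p)\<bar>" by (simp add: cos_abs_real)
  then have "cos (fst (F q) - fst (F p)) = - 1" by (simp add: pi)
  moreover have "norm (snd (F p)) = 1" "norm (snd (F q)) = 1"
    using F p q by (auto simp: weak_lift_def Ein_cover_iff image_subset_iff)
  then have "- 1 \<le> snd (F p) \<bullet> snd (F q)" by (rule inner_sphere_bounds)
  moreover obtain c where "c > 0"
    "snd (F p) \<bullet> snd (F q) - cos (fst (F q) - fst (F p)) = c * (snd p \<bullet> snd q - cos (fst q - fst p))"
    using inner_gap_scaled[OF g F p q] by blast
  moreover from this(1) gap have "c * (snd p \<bullet> snd q - cos (fst q - fst p)) < 0"
    by (simp add: mult_less_0_iff)
  ultimately show False by linarith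
qed

lemma weak_lift_fst_continuous:
  assumes F: "weak_lift g F" and f: "continuous_on A f" "f ` A \<subseteq> Ein_cover"
  shows "continuous_on A (\<lambda>y. fst (F (f y)) - c)"
proof -
  have "continuous_on A (\<lambda>y. F (f y))"
    using F f by (intro continuous_on_compose2[of Ein_cover F A f]) (auto simp: weak_lift_def)
  then show ?thesis by (intro continuous_intros)
qed

text \<open>
  The angle difference of the images vanishes at \<open>y = x\<close> and never equals \<open>\<pi>\<close> in absolute value as \<open>y\<close> varies over the
  connected sphere.
\<close>

lemma lift_horizontal_less_pi:
  fixes F :: "real \<times> (real ^ 'n::finite) \<Rightarrow> real \<times> (real ^ 'n)"
  assumes n: "CARD('n) \<ge> 2" and g: "g \<in> O2n" and F: "weak_lift g F"
    and x: "norm x = 1" and y: "norm y = 1"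
  shows "\<bar>fst (F (\<theta>, y)) - fst (F (\<theta>, x))\<bar> < pi"
proof (rule connected_avoiding_pi[of "sphere 0 1" "\<lambda>y. fst (F (\<theta>, y)) - fst (F (\<theta>, x))" x])
  show "connected (sphere (0 :: real ^ 'n) 1)" using n by (intro connected_sphere) simp
  show "continuous_on (sphere 0 1) (\<lambda>y. fst (F (\<theta>, y)) - fst (F (\<theta>, x)))"
    by (intro weak_lift_fst_continuous[OF F] continuous_intros) (auto simp: Ein_cover_iff)
  fix z :: "real ^ 'n" assume "z \<in> sphere 0 1"
  then have z: "norm z = 1" by simp
  show "\<bar>fst (F (\<theta>, z)) - fst (F (\<theta>, x))\<bar> \<noteq> pi"
  proof (cases "x \<bullet> z < 1")
    case True
    then show ?thesis
      using x z by (intro lift_never_antipodal[OF g F]) (auto simp: Ein_cover_iff)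
  next
    case False
    then have "x = z" using inner_eq_1_imp_eq[OF x z] by simp
    then show ?thesis using pi_neq_zero by simp
  qed
qed (use x y in simp_all)

text \<open>
  Move \<open>q\<close> vertically from the height of \<open>p\<close> to its own. Strictly before the end the gap is negative, so the
  angle difference of the images cannot reach \<open>\<pi>\<close>, and by continuity it is at most \<open>\<pi>\<close> at the end. Within this range
  the sign of the gap decides whether two points are acausal.
\<close>

lemma lift_preserves_acausal:
  fixes F :: "real \<times> (real ^ 'n::finite) \<Rightarrow> real \<times> (real ^ 'n)"
  assumes n: "CARD('n) \<ge> 2" and g: "g \<in> O2n" and F: "weak_lift g F"
    and p: "p \<in> Ein_cover" and q: "q \<in> Ein_cover" and ac: "acausal p q"
  shows "acausal (F p) (F q)"
proof -
  obtain \<theta> x \<eta> y where eq: "p = (\<theta>, x)" "q = (\<eta>, y)" by (cases p; cases q)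
  have x: "norm x = 1" and y: "norm y = 1" using p q by (auto simp: eq Ein_cover_iff)
  define d where "d = sdist x y"
  have d: "0 \<le> d" "d \<le> pi" "cos d = x \<bullet> y" using sdist_bounds[OF x y] cos_sdist[OF x y] by (auto simp: d_def)
  define h where "h = (\<lambda>t. fst (F (\<theta> + t, y)) - fst (F (\<theta>, x)))"
  have h0: "\<bar>h 0\<bar> < pi" using lift_horizontal_less_pi[OF n g F x y] by (simp add: h_def)
  have conth: "continuous_on A h" for A
    unfolding h_def by (intro weak_lift_fst_continuous[OF F] continuous_intros) (auto simp: Ein_cover_iff y)
  have open_case: "\<bar>h t\<bar> < pi" if t: "t \<in> {- d<..<d}" for t
  proof (rule connected_avoiding_pi[OF _ conth _ h0])
    fix s assume s: "s \<in> {- d<..<d}"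
    have "cos d < cos \<bar>s\<bar>" using s d by (intro cos_monotone_0_pi) auto
    then show "\<bar>h s\<bar> \<noteq> pi"
      unfolding h_def using x y d
      by (intro lift_never_antipodal[OF g F]) (auto simp: Ein_cover_iff cos_abs_real)
  qed (use t in auto)
  have ht: "\<bar>h t\<bar> \<le> pi" if t: "\<bar>t\<bar> \<le> d" for t
  proof (cases "d = 0")
    case True
    then show ?thesis using h0 t by simp
  next
    case False
    then have "closure {- d<..<d} = {- d..d}" using d by (intro closure_greaterThanLessThan) simp
    moreover have "h ` closure {- d<..<d} \<subseteq> {- pi..pi}"
    proof (rule image_closure_subset[OF conth])
      show "h ` {- d<..<d} \<subseteq> {- pi..pi}" using open_case by (force simp: abs_less_iff)
    qed simp
    moreover have "t \<in> {- d..d}" using t by auto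
    ultimately have "h t \<in> {- pi..pi}" by blast
    then show ?thesis by auto
  qed
  define D where "D = fst (F q) - fst (F p)"
  have dt: "\<bar>\<eta> - \<theta>\<bar> \<le> d" using ac by (simp add: acausal_def eq d_def)
  have Dpi: "\<bar>D\<bar> \<le> pi" using ht[OF dt] by (simp add: h_def D_def eq)
  have FS: "norm (snd (F p)) = 1" "norm (snd (F q)) = 1"
    using F p q by (auto simp: weak_lift_def Ein_cover_iff image_subset_iff)
  have "cos d \<le> cos \<bar>\<eta> - \<theta>\<bar>" using dt d by (intro cos_monotone_0_pi_le) auto
  then have "snd p \<bullet> snd q - cos (fst q - fst p) \<le> 0" using d by (simp add: eq cos_abs_real)
  moreover obtain c where "c > 0"
    "snd (F p) \<bullet> snd (F q) - cos D = c * (snd p \<bullet> snd q - cos (fst q - fst p))"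
    using inner_gap_scaled[OF g F p q] unfolding D_def by blast
  ultimately have "cos (sdist (snd (F p)) (snd (F q))) \<le> cos \<bar>D\<bar>"
    using FS by (simp add: cos_sdist cos_abs_real mult_le_0_iff)
      (metis diff_le_0_iff_le less_imp_le mult_le_0_iff)
  then show ?thesis
    using cos_mono_le_eq[of "sdist (snd (F p)) (snd (F q))" "\<bar>D\<bar>"] Dpi sdist_bounds[OF FS]
    by (simp only: acausal_def D_def abs_ge_zero simp_thms)
qed

text \<open>
  The inverse lift preserves acausality, so the images of \<open>p\<close> and of a point above \<open>q\<close> on the same vertical line are
  never acausal, in particular never of equal height. Far up that line the image is above \<open>F p\<close> by equivariance,
  hence it is so all along the line.
\<close>

lemma lift_preserves_chron:
  fixes F :: "real \<times> (real ^ 'n::finite) \<Rightarrow> real \<times> (real ^ 'n)"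
  assumes n: "CARD('n) \<ge> 2" and g: "g \<in> carrier SO0" and F: "lift_of g F"
    and p: "p \<in> Ein_cover" and q: "q \<in> Ein_cover" and pq: "chron p q"
  shows "chron (F p) (F q)"
proof -
  obtain \<eta> y where eq: "q = (\<eta>, y)" by (cases q)
  obtain G where FG: "homeomorphism Ein_cover Ein_cover F G" and wF: "weak_lift g F"
    using F unfolding lift_of_iff_weak_lift by blast
  obtain k where k: "k \<in> carrier SO0" "k o\<^sub>L g = id_blinfun" using SO0_inverse[OF g] by blast
  have wG: "weak_lift k G" using weak_lift_inverse[OF wF FG k(2)] .
  have not_ac: "\<not> acausal (F p) (F r)" if r: "r \<in> Ein_cover" "chron p r" for r
  proof
    assume "acausal (F p) (F r)"
    moreover have "F p \<in> Ein_cover" "F r \<in> Ein_cover" using wF p r by (auto simp: weak_lift_def)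
    ultimately have "acausal (G (F p)) (G (F r))"
      using lift_preserves_acausal[OF n SO0_subset_O2n[OF k(1)] wG] by blast
    then have "acausal p r" using FG p r by (simp add: homeomorphism_def)
    then show False using r(2) by (auto simp: acausal_def chron_def)
  qed
  define h where "h = (\<lambda>s. fst (F (\<eta> + s, y)) - fst (F p))"
  have y: "norm y = 1" using q by (simp add: eq Ein_cover_iff)
  have S: "(\<eta> + s, y) \<in> Ein_cover" for s using y by (simp add: Ein_cover_iff)
  have nz: "h s \<noteq> 0" if "s \<in> {0..}" for s
  proof
    assume "h s = 0"
    moreover have "chron p (\<eta> + s, y)" using pq that by (simp add: chron_def eq)
    moreover have "0 \<le> sdist (snd (F p)) (snd (F (\<eta> + s, y)))"
      using wF p S[of s] by (intro sdist_bounds) (auto simp: weak_lift_def Ein_cover_iff image_subset_iff)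
    ultimately show False using not_ac[OF S, of s] by (simp add: acausal_def h_def)
  qed
  have "connected (h ` {0..})"
    unfolding h_def
    by (intro connected_continuous_image weak_lift_fst_continuous[OF wF] continuous_intros)
      (auto simp: Ein_cover_iff y)
  from connected_real_sign[OF this nz] have "0 < h 0"
  proof
    assume neg: "\<forall>s\<in>{0..}. h s < 0"
    \<comment> \<open>N turns are enough to lift the image of q above the image of p.\<close>
    obtain N :: nat where N: "- h 0 / (2 * pi) < of_nat N" using reals_Archimedean2 by blast
    have "F (shift (int N) q) = shift (int N) (F q)" by (rule weak_lift_equivariant[OF n g wF q])
    then have "h (2 * pi * of_nat N) = h 0 + 2 * pi * of_nat N" by (simp add: h_def eq shift_def case_prod_unfold)
    moreover have "- h 0 < 2 * pi * of_nat N" using N by (simp add: field_simps)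
    moreover have "h (2 * pi * of_nat N) < 0" using neg by simp
    ultimately show "0 < h 0" by linarith
  qed auto
  moreover have "\<not> acausal (F p) (F q)" using not_ac[OF q pq] .
  ultimately show ?thesis by (simp add: h_def eq acausal_def chron_def)
qed

lemma lift_chron_iff:
  fixes F :: "real \<times> (real ^ 'n::finite) \<Rightarrow> real \<times> (real ^ 'n)"
  assumes n: "CARD('n) \<ge> 2" and g: "g \<in> carrier SO0" and F: "lift_of g F"
    and p: "p \<in> Ein_cover" and q: "q \<in> Ein_cover"
  shows "chron (F p) (F q) \<longleftrightarrow> chron p q"
proof
  assume FF: "chron (F p) (F q)"
  have not_rev: "\<not> chron q p"
  proof
    assume "chron q p"
    then have "chron (F q) (F p)" using lift_preserves_chron[OF n g F q p] by blast
    moreover have "0 \<le> sdist (snd (F p)) (snd (F q))"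
      using F p q by (intro sdist_bounds) (auto simp: lift_of_iff_weak_lift weak_lift_def Ein_cover_iff image_subset_iff)
    ultimately show False using FF by (simp add: chron_def sdist_commute)
  qed
  have "\<not> acausal p q"
  proof
    assume "acausal p q"
    then have "acausal (F p) (F q)"
      using F lift_preserves_acausal[OF n SO0_subset_O2n[OF g] _ p q] unfolding lift_of_iff_weak_lift by blast
    then show False using FF by (auto simp: acausal_def chron_def)
  qed
  then show "chron p q" using not_rev chron_or_acausal by blast
qed (rule lift_preserves_chron[OF n g F p q])

text \<open>
  Among the translates of \<open>q\<close> there is one that exceeds \<open>p\<close> in height by more than \<open>\<pi>\<close> and at most \<open>3 \<pi>\<close>. It is in the
  chronological future of \<open>p\<close> and this persists for the images, with the same translation by equivariance.
\<close>

lemma lift_displacement_oscillation: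
  fixes F :: "real \<times> (real ^ 'n::finite) \<Rightarrow> real \<times> (real ^ 'n)"
  assumes n: "CARD('n) \<ge> 2" and g: "g \<in> carrier SO0" and F: "lift_of g F"
    and p: "p \<in> Ein_cover" and q: "q \<in> Ein_cover"
  shows "fst (F p) - fst p - (fst (F q) - fst q) < 3 * pi"
proof -
  define k where "k = \<lfloor>(fst p - fst q + pi) / (2 * pi)\<rfloor> + 1"
  have "(fst p - fst q + pi) / (2 * pi) < of_int k" "of_int k \<le> (fst p - fst q + pi) / (2 * pi) + 1"
    unfolding k_def by linarith+
  then have k: "fst p - fst q + pi < 2 * pi * of_int k" "2 * pi * of_int k \<le> fst p - fst q + 3 * pi"
    by (simp_all add: field_simps)
  have S: "norm (snd p) = 1" "norm (snd q) = 1" using p q by (auto simp: Ein_cover_iff)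
  have wF: "weak_lift g F" using F by (simp add: lift_of_iff_weak_lift)
  have "chron p (shift k q)" using k sdist_bounds[OF S] by (simp add: chron_def)
  then have "chron (F p) (F (shift k q))"
    using lift_preserves_chron[OF n g F p] q by simp
  then have "chron (F p) (shift k (F q))" by (simp add: weak_lift_equivariant[OF n g wF q])
  moreover have "norm (snd (F p)) = 1" "norm (snd (F q)) = 1"
    using wF p q by (auto simp: weak_lift_def Ein_cover_iff image_subset_iff)
  then have "0 \<le> sdist (snd (F p)) (snd (F q))" by (rule sdist_bounds)
  ultimately show ?thesis using k by (simp add: chron_def)
qed

section \<open>The covering group and the Euler cocycle\<close>

text \<open>
  The translations \<open>shift k\<close> as elements of \<open>SO0_cover\<close>, which are extensional.
\<close>

definition deck_shift :: "int \<Rightarrow> real \<times> (real ^ 'n::finite) \<Rightarrow> real \<times> (real ^ 'n)" where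
  "deck_shift k = restrict (shift k) Ein_cover"

lemma deck_shift_apply [simp]: "y \<in> Ein_cover \<Longrightarrow> deck_shift k y = shift k y"
  by (simp add: deck_shift_def)

lemma lift_of_Bij: "lift_of g F \<Longrightarrow> F \<in> Bij Ein_cover"
  unfolding lift_of_def Bij_def homeomorphism_def bij_betw_def
  by (auto intro: inj_on_inverseI)

lemma lift_of_in_cover: "lift_of g F \<Longrightarrow> y \<in> Ein_cover \<Longrightarrow> F y \<in> Ein_cover"
  by (auto simp: lift_of_iff_weak_lift weak_lift_def)

lemma carrier_SO0_cover: "F \<in> carrier SO0_cover \<longleftrightarrow> (\<exists>g\<in>carrier SO0. lift_of g F)"
  by (simp add: SO0_cover_def)

lemma SO0_cover_mult:
  "lift_of g F \<Longrightarrow> lift_of h H \<Longrightarrow> F \<otimes>\<^bsub>SO0_cover\<^esub> H = compose Ein_cover F H"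
  by (simp add: SO0_cover_def BijGroup_def lift_of_Bij)

lemma lift_of_compose:
  assumes F: "lift_of g F" and H: "lift_of h H"
  shows "lift_of (g o\<^sub>L h) (compose Ein_cover F H)"
proof -
  obtain F' H' where hom: "homeomorphism Ein_cover Ein_cover F F'" "homeomorphism Ein_cover Ein_cover H H'"
    using F H by (auto simp: lift_of_def)
  have "homeomorphism Ein_cover Ein_cover (compose Ein_cover F H) (H' \<circ> F')"
    by (rule homeomorphism_cong[OF homeomorphism_compose[OF hom(2,1)]]) (auto simp: compose_def)
  moreover have "weak_lift (g o\<^sub>L h) (compose Ein_cover F H)"
    using weak_lift_compose[of g F h H] F H
    by (auto simp: lift_of_iff_weak_lift weak_lift_def compose_def cong: continuous_on_cong)
  ultimately show ?thesis unfolding lift_of_iff_weak_lift by (auto simp: compose_def)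
qed

lemma lift_of_inverse:
  assumes g: "g \<in> carrier SO0" and F: "lift_of g F"
  obtains h H where "h \<in> carrier SO0" "lift_of h H"
    "compose Ein_cover H F = (\<lambda>y\<in>Ein_cover. y)"
proof -
  obtain G where FG: "homeomorphism Ein_cover Ein_cover F G" and wF: "weak_lift g F"
    using F unfolding lift_of_iff_weak_lift by blast
  obtain h where h: "h \<in> carrier SO0" "h o\<^sub>L g = id_blinfun" using SO0_inverse[OF g] by blast
  have "lift_of h (restrict G Ein_cover)"
    by (rule lift_of_restrict_homeomorphism[OF weak_lift_inverse[OF wF FG h(2)]])
      (use FG homeomorphism_symD in blast)
  moreover have "compose Ein_cover (restrict G Ein_cover) F = (\<lambda>y\<in>Ein_cover. y)"
    using FG by (auto simp: compose_def homeomorphism_def fun_eq_iff)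
  ultimately show ?thesis using h(1) that by blast
qed

lemma deck_shift_lift: "lift_of id_blinfun (deck_shift k)"
  unfolding deck_shift_def
proof (rule lift_of_restrict_homeomorphism[OF weak_lift_shift_id])
  show "homeomorphism Ein_cover Ein_cover (shift k) (shift (- k))"
    using weak_lift_shift_id[of k] weak_lift_shift_id[of "- k"]
    by (intro homeomorphismI) (auto simp: weak_lift_def)
qed

lemma group_SO0_cover: "group (SO0_cover :: (real \<times> (real ^ 'n::finite) \<Rightarrow> _) monoid)"
proof -
  interpret B: group "BijGroup (Ein_cover :: (real \<times> (real ^ 'n)) set)" by (rule group_BijGroup)
  let ?L = "{F :: real \<times> (real ^ 'n) \<Rightarrow> _. \<exists>g\<in>carrier SO0. lift_of g F}"
  have "subgroup ?L (BijGroup Ein_cover)"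
  proof (rule B.subgroupI)
    show "?L \<subseteq> carrier (BijGroup Ein_cover)" by (auto simp: BijGroup_def lift_of_Bij)
    show "?L \<noteq> {}" using deck_shift_lift SO0_id by blast
  next
    fix F assume "F \<in> ?L"
    then obtain g where g: "g \<in> carrier SO0" "lift_of g F" by blast
    obtain h H where h: "h \<in> carrier SO0" "lift_of h H" "compose Ein_cover H F = (\<lambda>y\<in>Ein_cover. y)"
      using lift_of_inverse[OF g] by blast
    have "inv\<^bsub>BijGroup Ein_cover\<^esub> F = H"
      using g h by (intro B.inv_equality) (auto simp: BijGroup_def lift_of_Bij)
    then show "inv\<^bsub>BijGroup Ein_cover\<^esub> F \<in> ?L" using h by blast
  next
    fix F H assume "F \<in> ?L" "H \<in> ?L"
    then obtain g h where gh: "g \<in> carrier SO0" "lift_of g F" "h \<in> carrier SO0" "lift_of h H" by blast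
    then have "F \<otimes>\<^bsub>BijGroup Ein_cover\<^esub> H = compose Ein_cover F H"
      by (simp add: BijGroup_def lift_of_Bij)
    then show "F \<otimes>\<^bsub>BijGroup Ein_cover\<^esub> H \<in> ?L"
      using lift_of_compose[OF gh(2,4)] SO0_compose[OF gh(1,3)] by auto
  qed
  then have "group ((BijGroup Ein_cover)\<lparr>carrier := ?L\<rparr>)"
    by (rule subgroup.subgroup_is_group) (rule group_BijGroup)
  then show ?thesis by (simp add: SO0_cover_def)
qed

lemma one_SO0_cover: "\<one>\<^bsub>SO0_cover\<^esub> = deck_shift 0"
  unfolding SO0_cover_def BijGroup_def monoid.simps partial_object.simps
    deck_shift_def
  by (rule restrict_ext) simp

lemma deck_shift_mult_apply:
  assumes "lift_of g F" "y \<in> Ein_cover"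
  shows "(deck_shift k \<otimes>\<^bsub>SO0_cover\<^esub> F) y = shift k (F y)"
  using assms lift_of_in_cover[OF assms]
  by (simp add: SO0_cover_mult[OF deck_shift_lift assms(1)] compose_def)

lemma deck_shift_mult: "deck_shift k \<otimes>\<^bsub>SO0_cover\<^esub> deck_shift l = deck_shift (k + l)"
  unfolding SO0_cover_mult[OF deck_shift_lift deck_shift_lift] compose_def deck_shift_def[of "k + l"]
  by (rule restrict_ext) simp

lemma deck_shift_mult_lift:
  assumes "lift_of g F"
  shows "lift_of g (deck_shift k \<otimes>\<^bsub>SO0_cover\<^esub> F)"
proof -
  have "id_blinfun o\<^sub>L g = g" by (rule blinfun_eqI) simp
  then show ?thesis
    using lift_of_compose[OF deck_shift_lift assms, of k]
    by (simp add: SO0_cover_mult[OF deck_shift_lift assms])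
qed

lemma deck_shift_carrier [simp]: "deck_shift k \<in> carrier SO0_cover"
  using deck_shift_lift SO0_id carrier_SO0_cover by blast

text \<open>
  This identifies the integer powers in the definition of the Euler cocycle with explicit translations.
\<close>

lemma deck_int_pow:
  "(deck :: real \<times> (real ^ 'n::finite) \<Rightarrow> _) [^]\<^bsub>SO0_cover\<^esub> k = deck_shift k"
proof -
  interpret C: group "SO0_cover :: (real \<times> (real ^ 'n) \<Rightarrow> real \<times> (real ^ 'n)) monoid" by (rule group_SO0_cover)
  have deck: "(deck :: real \<times> (real ^ 'n) \<Rightarrow> _) = deck_shift 1" 
    unfolding deck_def deck_shift_def by (rule restrict_ext) (auto simp: shift_def)
  have dc: "(deck :: real \<times> (real ^ 'n) \<Rightarrow> _) \<in> carrier SO0_cover" unfolding deck by simp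
  show ?thesis
  proof (induction k rule: int_induct[where k = 0])
    case base
    show ?case unfolding int_pow_0 by (rule one_SO0_cover)
  next
    case (step1 i)
    have "(deck :: real \<times> (real ^ 'n) \<Rightarrow> _) [^]\<^bsub>SO0_cover\<^esub> (i + 1) = deck [^]\<^bsub>SO0_cover\<^esub> i \<otimes>\<^bsub>SO0_cover\<^esub> deck"
      using dc by (simp add: C.int_pow_mult)
    also have "\<dots> = deck_shift (i + 1)" unfolding step1 unfolding deck by (rule deck_shift_mult)
    finally show ?case .
  next
    case (step2 i)
    have "(deck :: real \<times> (real ^ 'n) \<Rightarrow> _) [^]\<^bsub>SO0_cover\<^esub> (i - 1) \<otimes>\<^bsub>SO0_cover\<^esub> deck = deck [^]\<^bsub>SO0_cover\<^esub> (i - 1 + 1)"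
      using dc by (simp only: C.int_pow_mult C.int_pow_1)
    also have "\<dots> = deck_shift i" using step2(2) by (simp only: diff_add_cancel)
    also have "\<dots> = deck_shift (i - 1) \<otimes>\<^bsub>SO0_cover\<^esub> deck"
      unfolding deck by (simp only: deck_shift_mult diff_add_cancel)
    finally show ?case using dc by (simp add: C.right_cancel C.int_pow_closed)
  qed
qed

lemma deck_shift_central:
  fixes F :: "real \<times> (real ^ 'n::finite) \<Rightarrow> real \<times> (real ^ 'n)"
  assumes n: "CARD('n) \<ge> 2" and g: "g \<in> carrier SO0" and F: "lift_of g F"
  shows "F \<otimes>\<^bsub>SO0_cover\<^esub> deck_shift k = deck_shift k \<otimes>\<^bsub>SO0_cover\<^esub> F"
proof -
  have "weak_lift g F" using F by (simp add: lift_of_iff_weak_lift)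
  note eqv = weak_lift_equivariant[OF n g this]
  show ?thesis
    unfolding SO0_cover_mult[OF deck_shift_lift F] SO0_cover_mult[OF F deck_shift_lift] compose_def
    using lift_of_in_cover[OF F] eqv by (intro restrict_ext) simp
qed

lemma lifts_differ_by_deck_shift:
  fixes F H :: "real \<times> (real ^ 'n::finite) \<Rightarrow> real \<times> (real ^ 'n)"
  assumes n: "CARD('n) \<ge> 2" and F: "lift_of g F" and H: "lift_of g H"
  obtains k where "H = deck_shift k \<otimes>\<^bsub>SO0_cover\<^esub> F"
proof -
  obtain k where k: "\<And>y. y \<in> Ein_cover \<Longrightarrow> H y = shift k (F y)"
    using weak_lift_unique[OF n, of g F H] F H unfolding lift_of_iff_weak_lift by blast
  have "H \<in> extensional Ein_cover" "F \<in> extensional Ein_cover" using F H by (auto simp: lift_of_def)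
  then have "H = deck_shift k \<otimes>\<^bsub>SO0_cover\<^esub> F"
    unfolding SO0_cover_mult[OF deck_shift_lift F]
    using k lift_of_in_cover[OF F] by (auto simp: compose_def fun_eq_iff extensional_def)
  then show ?thesis by (rule that)
qed

lemma deck_shift_mult_inject:
  fixes x0 :: "real ^ 'n::finite" and F :: "real \<times> (real ^ 'n) \<Rightarrow> real \<times> (real ^ 'n)"
  assumes F: "lift_of g F" and x0: "norm x0 = 1"
    and eq: "deck_shift k \<otimes>\<^bsub>SO0_cover\<^esub> F = deck_shift l \<otimes>\<^bsub>SO0_cover\<^esub> F"
  shows "k = l"
proof -
  have "(0, x0) \<in> Ein_cover" using x0 by (simp add: Ein_cover_iff)
  then have "shift k (F (0, x0)) = shift l (F (0, x0))"
    using fun_cong[OF eq, of "(0, x0)"] by (simp add: deck_shift_mult_apply[OF F])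
  then show ?thesis by simp
qed

text \<open>
  The interval \<open>{- \<pi>..<\<pi>}\<close> is a fundamental domain for translation by \<open>2 \<pi>\<close>, so exactly one of the lifts, which form a
  single orbit of the deck group, sends the base point into it.
\<close>

lemma lift_section_props:
  fixes x0 :: "real ^ 'n::finite"
  assumes n: "CARD('n) \<ge> 2" and x0: "norm x0 = 1" and g: "g \<in> carrier SO0"
  shows "lift_of g (lift_section x0 g)" "fst (lift_section x0 g (0, x0)) \<in> {- pi..<pi}"
proof -
  have base: "(0, x0) \<in> Ein_cover" using x0 by (simp add: Ein_cover_iff)
  obtain F where F: "lift_of g F" using SO0_lift_exists[OF n g] by blast
  define k where "k = - \<lfloor>(fst (F (0, x0)) + pi) / (2 * pi)\<rfloor>"
  have "- of_int k \<le> (fst (F (0, x0)) + pi) / (2 * pi)" "(fst (F (0, x0)) + pi) / (2 * pi) < 1 - of_int k"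
    unfolding k_def by linarith+
  then have k: "- pi \<le> fst (F (0, x0)) + 2 * pi * of_int k" "fst (F (0, x0)) + 2 * pi * of_int k < pi"
    by (simp_all add: field_simps)
  let ?P = "\<lambda>H. lift_of g H \<and> H (0, x0) \<in> {- pi..<pi} \<times> sphere 0 1"
  have "\<exists>!H. ?P H"
  proof (rule ex1I)
    show "?P (deck_shift k \<otimes>\<^bsub>SO0_cover\<^esub> F)"
      using k lift_of_in_cover[OF F base] deck_shift_mult_lift[OF F]
      by (simp add: deck_shift_mult_apply[OF F base] mem_Times_iff Ein_cover_iff)
    fix H assume H: "?P H"
    obtain l where l: "H = deck_shift l \<otimes>\<^bsub>SO0_cover\<^esub> F"
      using lifts_differ_by_deck_shift[OF n F] H by blast
    have "- pi \<le> fst (F (0, x0)) + 2 * pi * of_int l" "fst (F (0, x0)) + 2 * pi * of_int l < pi"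
      using H by (auto simp: l deck_shift_mult_apply[OF F base] mem_Times_iff)
    with k have "2 * pi * (of_int l - of_int k) < 2 * pi * 1" "2 * pi * (of_int k - of_int l) < 2 * pi * 1"
      by (simp_all add: algebra_simps)
    then have "of_int l - of_int k < (1::real)" "of_int k - of_int l < (1::real)"
      by (simp_all only: mult_less_cancel_left_pos pi_gt_zero zero_less_numeral zero_less_mult_iff simp_thms disj_not1)
    then have "l = k" by linarith
    then show "H = deck_shift k \<otimes>\<^bsub>SO0_cover\<^esub> F" using l by simp
  qed
  from theI'[OF this] have "?P (lift_section x0 g)" unfolding lift_section_def .
  then show "lift_of g (lift_section x0 g)" "fst (lift_section x0 g (0, x0)) \<in> {- pi..<pi}"
    by (auto simp: mem_Times_iff)
qed

lemma euler_cocycle_eqI: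
  fixes x0 :: "real ^ 'n::finite"
  assumes n: "CARD('n) \<ge> 2" and x0: "norm x0 = 1" and g: "g \<in> carrier SO0" and h: "h \<in> carrier SO0"
    and eq: "lift_section x0 (g o\<^sub>L h) =
      deck_shift k \<otimes>\<^bsub>SO0_cover\<^esub> (lift_section x0 g \<otimes>\<^bsub>SO0_cover\<^esub> lift_section x0 h)"
  shows "euler_cocycle x0 (g, h) = k"
proof -
  note s = lift_section_props(1)[OF n x0]
  have "lift_of (g o\<^sub>L h) (lift_section x0 g \<otimes>\<^bsub>SO0_cover\<^esub> lift_section x0 h)"
    using lift_of_compose[OF s[OF g] s[OF h]] by (simp add: SO0_cover_mult[OF s[OF g] s[OF h]])
  note inject = deck_shift_mult_inject[OF this x0]
  have "euler_cocycle x0 (g, h) = (THE l. lift_section x0 (g o\<^sub>L h) =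
      deck_shift l \<otimes>\<^bsub>SO0_cover\<^esub> (lift_section x0 g \<otimes>\<^bsub>SO0_cover\<^esub> lift_section x0 h))"
    using g h by (simp add: euler_cocycle_def deck_int_pow)
  also have "\<dots> = k"
    using eq by (intro the_equality) (auto dest: inject)
  finally show ?thesis .
qed

lemma euler_cocycle_lift_section:
  fixes x0 :: "real ^ 'n::finite"
  assumes n: "CARD('n) \<ge> 2" and x0: "norm x0 = 1" and g: "g \<in> carrier SO0" and h: "h \<in> carrier SO0"
  shows "lift_section x0 (g o\<^sub>L h) =
      deck_shift (euler_cocycle x0 (g, h)) \<otimes>\<^bsub>SO0_cover\<^esub> (lift_section x0 g \<otimes>\<^bsub>SO0_cover\<^esub> lift_section x0 h)"
proof -
  note s = lift_section_props(1)[OF n x0]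
  have "lift_of (g o\<^sub>L h) (lift_section x0 g \<otimes>\<^bsub>SO0_cover\<^esub> lift_section x0 h)"
    using lift_of_compose[OF s[OF g] s[OF h]] by (simp add: SO0_cover_mult[OF s[OF g] s[OF h]])
  then obtain k where "lift_section x0 (g o\<^sub>L h) =
      deck_shift k \<otimes>\<^bsub>SO0_cover\<^esub> (lift_section x0 g \<otimes>\<^bsub>SO0_cover\<^esub> lift_section x0 h)"
    using lifts_differ_by_deck_shift[OF n _ s[OF SO0_compose[OF g h]]] by blast
  then show ?thesis using euler_cocycle_eqI[OF n x0 g h] by simp
qed

section \<open>Vanishing in bounded cohomology\<close>

text \<open>
  The trivial class is the set of coboundaries itself, so the claim is that a coset of this subgroup
  equals it exactly if it contains the representative.
\<close>

lemma H2b_class_trivial_iff: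
  assumes G: "group G" and ext: "\<phi> \<in> extensional (carrier G \<times> carrier G)"
  shows "H2b_class G \<phi> = \<one>\<^bsub>H2b G\<^esub> \<longleftrightarrow> \<phi> \<in> bounded_coboundaries2 G"
proof -
  interpret group G by (rule G)
  let ?B = "bounded_coboundaries2 G"
  have one: "\<one>\<^bsub>H2b G\<^esub> = ?B" by (simp add: H2b_def FactGroup_def)
  have class_eq: "H2b_class G \<phi> = (\<lambda>\<psi>. \<lambda>p\<in>carrier G \<times> carrier G. \<psi> p + \<phi> p) ` ?B"
    by (auto simp: H2b_class_def r_coset_def bounded_cocycle_group2_def)
  have combine: "(\<lambda>p\<in>carrier G \<times> carrier G. coboundary1 G a p + s * coboundary1 G b p) \<in> ?B"
    if a: "a \<in> bounded_cochains1 G" and b: "b \<in> bounded_cochains1 G" and s: "\<bar>s\<bar> = 1" for a b s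
  proof -
    obtain K where K: "\<And>g. g \<in> carrier G \<Longrightarrow> \<bar>a g\<bar> \<le> K"
      using a unfolding bounded_cochains1_def by blast
    obtain L where L: "\<And>g. g \<in> carrier G \<Longrightarrow> \<bar>b g\<bar> \<le> L"
      using b unfolding bounded_cochains1_def by blast
    define e where "e = (\<lambda>g\<in>carrier G. a g + s * b g)"
    have "\<bar>e g\<bar> \<le> K + L" if "g \<in> carrier G" for g
      using K[OF that] L[OF that] s abs_triangle_ineq[of "a g" "s * b g"] that by (simp add: e_def abs_mult)
    then have "e \<in> bounded_cochains1 G" by (auto simp: bounded_cochains1_def e_def)
    moreover have "(\<lambda>p\<in>carrier G \<times> carrier G. coboundary1 G a p + s * coboundary1 G b p) = coboundary1 G e"
      by (auto simp: coboundary1_def e_def fun_eq_iff algebra_simps)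
    ultimately show ?thesis by (auto simp: bounded_coboundaries2_def)
  qed
  show ?thesis
  proof
    assume "H2b_class G \<phi> = \<one>\<^bsub>H2b G\<^esub>"
    then have "(\<lambda>\<psi>. \<lambda>p\<in>carrier G \<times> carrier G. \<psi> p + \<phi> p) ` ?B = ?B" using one class_eq by simp
    moreover have "coboundary1 G (\<lambda>g\<in>carrier G. 0) \<in> ?B"
      by (auto simp: bounded_coboundaries2_def bounded_cochains1_def intro!: imageI)
    ultimately have "(\<lambda>p\<in>carrier G \<times> carrier G. coboundary1 G (\<lambda>g\<in>carrier G. 0) p + \<phi> p) \<in> ?B" by blast
    also have "(\<lambda>p\<in>carrier G \<times> carrier G. coboundary1 G (\<lambda>g\<in>carrier G. 0) p + \<phi> p) = \<phi>"
      using ext by (auto simp: coboundary1_def fun_eq_iff extensional_def)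
    finally show "\<phi> \<in> ?B" .
  next
    assume "\<phi> \<in> ?B"
    then obtain b where b: "b \<in> bounded_cochains1 G" "\<phi> = coboundary1 G b"
      by (auto simp: bounded_coboundaries2_def)
    have "(\<lambda>\<psi>. \<lambda>p\<in>carrier G \<times> carrier G. \<psi> p + \<phi> p) ` ?B = ?B"
    proof
      show "(\<lambda>\<psi>. \<lambda>p\<in>carrier G \<times> carrier G. \<psi> p + \<phi> p) ` ?B \<subseteq> ?B"
        using combine[OF _ b(1), of _ 1] by (auto simp: b(2) bounded_coboundaries2_def)
      show "?B \<subseteq> (\<lambda>\<psi>. \<lambda>p\<in>carrier G \<times> carrier G. \<psi> p + \<phi> p) ` ?B"
      proof
        fix \<psi> assume "\<psi> \<in> ?B"
        then obtain a where a: "a \<in> bounded_cochains1 G" "\<psi> = coboundary1 G a"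
          by (auto simp: bounded_coboundaries2_def)
        let ?\<chi> = "\<lambda>p\<in>carrier G \<times> carrier G. coboundary1 G a p + (- 1) * coboundary1 G b p"
        have "?\<chi> \<in> ?B" by (rule combine[OF a(1) b(1)]) simp
        moreover have "\<psi> = (\<lambda>p\<in>carrier G \<times> carrier G. ?\<chi> p + \<phi> p)"
          by (auto simp: a(2) b(2) coboundary1_def fun_eq_iff)
        ultimately show "\<psi> \<in> (\<lambda>\<psi>. \<lambda>p\<in>carrier G \<times> carrier G. \<psi> p + \<phi> p) ` ?B" by blast
      qed
    qed
    then show "H2b_class G \<phi> = \<one>\<^bsub>H2b G\<^esub>" using one class_eq by simp
  qed
qed

section \<open>Invariant achronal spheres\<close>

text \<open>
  The height \<open>f\<close> is the supremum over \<open>Q\<close> of the heights of the past light cones \<open>fst q - sdist x (snd q)\<close>, each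
  of which is 1-Lipschitz in \<open>x\<close> by the triangle inequality.
\<close>

lemma past_boundary_height:
  fixes Q :: "(real \<times> (real ^ 'n::finite)) set"
  assumes Q: "Q \<subseteq> Ein_cover" "Q \<noteq> {}" and M: "\<And>q. q \<in> Q \<Longrightarrow> fst q \<le> M"
  obtains f where "lipschitz_height f"
    "\<And>p. p \<in> Ein_cover \<Longrightarrow> (\<exists>q\<in>Q. chron p q) \<longleftrightarrow> fst p < f (snd p)"
proof
  define f where "f = (\<lambda>x. SUP q\<in>Q. fst q - sdist x (snd q))"
  have unit: "norm (snd q) = 1" if "q \<in> Q" for q using Q that by (auto simp: Ein_cover_iff)
  have bdd: "bdd_above ((\<lambda>q. fst q - sdist x (snd q)) ` Q)" if x: "norm x = 1" for x
  proof (rule bdd_aboveI2)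
    fix q assume q: "q \<in> Q"
    show "fst q - sdist x (snd q) \<le> M" using M[OF q] sdist_bounds[OF x unit[OF q]] by simp
  qed
  show "lipschitz_height f"
    unfolding lipschitz_height_def
  proof (intro ballI)
    fix x y :: "real ^ 'n" assume "x \<in> sphere 0 1" "y \<in> sphere 0 1"
    then have x: "norm x = 1" and y: "norm y = 1" by auto
    have "f x \<le> f y + sdist x y"
      unfolding f_def
    proof (rule cSUP_least[OF Q(2)])
      fix q assume q: "q \<in> Q"
      have "fst q - sdist y (snd q) \<le> (SUP q\<in>Q. fst q - sdist y (snd q))"
        by (rule cSUP_upper[OF q bdd[OF y]])
      moreover have "sdist y (snd q) \<le> sdist y x + sdist x (snd q)"
        by (rule sdist_triangle[OF y x unit[OF q]])
      ultimately show "fst q - sdist x (snd q) \<le> (SUP q\<in>Q. fst q - sdist y (snd q)) + sdist x y"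
        by (simp add: sdist_commute[of y x])
    qed
    then show "f x - f y \<le> sdist x y" by simp
  qed
  fix p :: "real \<times> (real ^ 'n)" assume "p \<in> Ein_cover"
  then have p: "norm (snd p) = 1" by (simp add: Ein_cover_iff)
  show "(\<exists>q\<in>Q. chron p q) \<longleftrightarrow> fst p < f (snd p)"
    unfolding f_def less_cSUP_iff[OF Q(2) bdd[OF p]] chron_def by (auto simp: algebra_simps)
qed

text \<open>
  The graph is recovered from the region under it by the order alone: its points are outside the region,
  but their chronological past is inside. Points strictly above the graph fail this, since the graph point below them is in
  their past and outside the region.
\<close>

lemma height_graph_order_characterization:
  assumes f: "lipschitz_height f" and p: "p \<in> Ein_cover"
  shows "p \<in> height_graph f \<longleftrightarrow>
    \<not> fst p < f (snd p) \<and> (\<forall>q\<in>Ein_cover. chron q p \<longrightarrow> fst q < f (snd q))"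
proof -
  have graph: "p \<in> height_graph f \<longleftrightarrow> fst p = f (snd p)"
    using p by (cases p) (auto simp: height_graph_def Ein_cover_iff)
  have up: "fst q < f (snd q)" if q: "q \<in> Ein_cover" "chron q p" and eq: "fst p = f (snd p)" for q
  proof -
    have "f (snd p) - f (snd q) \<le> sdist (snd p) (snd q)"
      using f p q by (auto simp: lipschitz_height_def Ein_cover_iff)
    then show ?thesis using q(2) eq by (simp add: chron_def sdist_commute)
  qed
  have down: "fst p \<le> f (snd p)" if below: "\<forall>q\<in>Ein_cover. chron q p \<longrightarrow> fst q < f (snd q)"
  proof (rule ccontr)
    assume less: "\<not> fst p \<le> f (snd p)"
    have "(f (snd p), snd p) \<in> Ein_cover" "chron (f (snd p), snd p) p"
      using p less by (auto simp: Ein_cover_iff chron_def)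
    then show False using below by force
  qed
  show ?thesis
    unfolding graph using up down by (auto simp: not_less intro: antisym)
qed

text \<open>
  An automorphism of the order that maps \<open>Q\<close> onto itself preserves the past of \<open>Q\<close>, hence everything that is
  characterised by it through the order.
\<close>

lemma height_graph_invariant:
  fixes F :: "real \<times> (real ^ 'n::finite) \<Rightarrow> real \<times> (real ^ 'n)"
  assumes f: "lipschitz_height f"
    and Q: "Q \<subseteq> Ein_cover" "\<And>p. p \<in> Ein_cover \<Longrightarrow> (\<exists>q\<in>Q. chron p q) \<longleftrightarrow> fst p < f (snd p)"
    and F: "bij_betw F Ein_cover Ein_cover"
    and order: "\<And>p q. p \<in> Ein_cover \<Longrightarrow> q \<in> Ein_cover \<Longrightarrow> chron (F p) (F q) \<longleftrightarrow> chron p q"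
    and FQ: "F ` Q = Q"
  shows "F ` height_graph f = height_graph f"
proof -
  have FS: "F p \<in> Ein_cover" if "p \<in> Ein_cover" for p using bij_betw_apply[OF F that] .
  have below: "fst (F p) < f (snd (F p)) \<longleftrightarrow> fst p < f (snd p)" if p: "p \<in> Ein_cover" for p
  proof -
    have "(\<exists>q\<in>Q. chron (F p) q) \<longleftrightarrow> (\<exists>q\<in>Q. chron (F p) (F q))" using FQ by (metis (no_types, lifting) imageE imageI)
    also have "\<dots> \<longleftrightarrow> (\<exists>q\<in>Q. chron p q)" using order[OF p] Q(1) by blast
    finally show ?thesis using Q(2)[OF p] Q(2)[OF FS[OF p]] by simp
  qed
  have graph: "F p \<in> height_graph f \<longleftrightarrow> p \<in> height_graph f" if p: "p \<in> Ein_cover" for p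
  proof -
    have "(\<forall>q\<in>Ein_cover. chron q (F p) \<longrightarrow> fst q < f (snd q)) \<longleftrightarrow>
        (\<forall>q\<in>F ` Ein_cover. chron q (F p) \<longrightarrow> fst q < f (snd q))"
      using F by (simp add: bij_betw_def)
    also have "\<dots> \<longleftrightarrow> (\<forall>q\<in>Ein_cover. chron q p \<longrightarrow> fst q < f (snd q))"
      using order[OF _ p] below by auto
    finally show ?thesis
      using below[OF p] by (simp add: height_graph_order_characterization[OF f] p FS)
  qed
  have sub: "height_graph f \<subseteq> Ein_cover" by (auto simp: height_graph_def Ein_cover_iff)
  show ?thesis
  proof
    show "F ` height_graph f \<subseteq> height_graph f" using graph sub by blast
    show "height_graph f \<subseteq> F ` height_graph f"
    proof
      fix q assume q: "q \<in> height_graph f"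
      then obtain p where "p \<in> Ein_cover" "q = F p" using F sub by (force simp: bij_betw_def)
      then show "q \<in> F ` height_graph f" using graph q by blast
    qed
  qed
qed

section \<open>Comparing lifts with the section\<close>

lemma deck_shift_mult_assoc:
  assumes F: "lift_of g F" "g \<in> carrier SO0"
  shows "deck_shift k \<otimes>\<^bsub>SO0_cover\<^esub> (deck_shift l \<otimes>\<^bsub>SO0_cover\<^esub> F) = deck_shift (k + l) \<otimes>\<^bsub>SO0_cover\<^esub> F"
proof -
  have "F \<in> carrier SO0_cover" using F carrier_SO0_cover by blast
  then show ?thesis
    by (simp only: monoid.m_assoc[OF group.is_monoid[OF group_SO0_cover], symmetric] deck_shift_carrier deck_shift_mult)
qed

text \<open>
  Deck transformations are central, so their exponents add up in front of a product.
\<close>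

lemma deck_shift_mult_mult:
  fixes F H :: "real \<times> (real ^ 'n::finite) \<Rightarrow> real \<times> (real ^ 'n)"
  assumes n: "CARD('n) \<ge> 2" and F: "lift_of g F" "g \<in> carrier SO0" and H: "lift_of h H" "h \<in> carrier SO0"
  shows "(deck_shift k \<otimes>\<^bsub>SO0_cover\<^esub> F) \<otimes>\<^bsub>SO0_cover\<^esub> (deck_shift l \<otimes>\<^bsub>SO0_cover\<^esub> H) =
    deck_shift (k + l) \<otimes>\<^bsub>SO0_cover\<^esub> (F \<otimes>\<^bsub>SO0_cover\<^esub> H)"
proof -
  interpret C: group "SO0_cover :: (real \<times> (real ^ 'n) \<Rightarrow> real \<times> (real ^ 'n)) monoid" by (rule group_SO0_cover)
  have car: "F \<in> carrier SO0_cover" "H \<in> carrier SO0_cover" using F H carrier_SO0_cover by blast+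
  have "(deck_shift k \<otimes>\<^bsub>SO0_cover\<^esub> F) \<otimes>\<^bsub>SO0_cover\<^esub> (deck_shift l \<otimes>\<^bsub>SO0_cover\<^esub> H)
      = deck_shift k \<otimes>\<^bsub>SO0_cover\<^esub> ((F \<otimes>\<^bsub>SO0_cover\<^esub> deck_shift l) \<otimes>\<^bsub>SO0_cover\<^esub> H)"
    using car by (simp only: C.m_assoc C.m_closed deck_shift_carrier)
  also have "F \<otimes>\<^bsub>SO0_cover\<^esub> deck_shift l = deck_shift l \<otimes>\<^bsub>SO0_cover\<^esub> F"
    by (rule deck_shift_central[OF n F(2,1)])
  also have "deck_shift k \<otimes>\<^bsub>SO0_cover\<^esub> ((deck_shift l \<otimes>\<^bsub>SO0_cover\<^esub> F) \<otimes>\<^bsub>SO0_cover\<^esub> H)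
      = (deck_shift k \<otimes>\<^bsub>SO0_cover\<^esub> deck_shift l) \<otimes>\<^bsub>SO0_cover\<^esub> (F \<otimes>\<^bsub>SO0_cover\<^esub> H)"
    using car by (simp only: C.m_assoc C.m_closed deck_shift_carrier)
  finally show ?thesis by (simp only: deck_shift_mult)
qed

text \<open>
  The orbit of \<open>y\<close> serves as the invariant set \<open>Q\<close>; the bound on its height makes the supremum that defines \<open>f\<close>
  finite.
\<close>

lemma bounded_lift_preserves_sphere:
  fixes \<Gamma> :: "('g, 'm) monoid_scheme" and \<rho>' :: "'g \<Rightarrow> real \<times> (real ^ 'n::finite) \<Rightarrow> real \<times> (real ^ 'n)"
  assumes n: "CARD('n) \<ge> 2" and \<Gamma>: "group \<Gamma>" and hom: "\<rho>' \<in> hom \<Gamma> SO0_cover"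
    and y: "y \<in> Ein_cover" and M: "\<And>\<gamma>. \<gamma> \<in> carrier \<Gamma> \<Longrightarrow> fst (\<rho>' \<gamma> y) \<le> M"
  obtains \<Lambda> where "closed_achronal_sphere \<Lambda>" "\<And>\<gamma>. \<gamma> \<in> carrier \<Gamma> \<Longrightarrow> \<rho>' \<gamma> ` \<Lambda> = \<Lambda>"
proof -
  interpret group \<Gamma> by (rule \<Gamma>)
  define Q where "Q = (\<lambda>\<gamma>. \<rho>' \<gamma> y) ` carrier \<Gamma>"
  have lift: "\<exists>g\<in>carrier SO0. lift_of g (\<rho>' \<gamma>)" if "\<gamma> \<in> carrier \<Gamma>" for \<gamma>
    using hom_in_carrier[OF hom that] by (simp add: carrier_SO0_cover)
  have mult: "\<rho>' (\<gamma> \<otimes>\<^bsub>\<Gamma>\<^esub> \<gamma>') y = \<rho>' \<gamma> (\<rho>' \<gamma>' y)" if \<gamma>: "\<gamma> \<in> carrier \<Gamma>" "\<gamma>' \<in> carrier \<Gamma>" for \<gamma> \<gamma>'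
  proof -
    obtain g g' where "lift_of g (\<rho>' \<gamma>)" "lift_of g' (\<rho>' \<gamma>')"
      using lift[OF \<gamma>(1)] lift[OF \<gamma>(2)] by blast
    then have "\<rho>' \<gamma> \<otimes>\<^bsub>SO0_cover\<^esub> \<rho>' \<gamma>' = compose Ein_cover (\<rho>' \<gamma>) (\<rho>' \<gamma>')" by (rule SO0_cover_mult)
    then show ?thesis using hom_mult[OF hom \<gamma>] y by (simp add: compose_def)
  qed
  have QS: "Q \<subseteq> Ein_cover"
  proof
    fix q assume "q \<in> Q"
    then obtain \<gamma> where \<gamma>: "\<gamma> \<in> carrier \<Gamma>" "q = \<rho>' \<gamma> y" by (auto simp: Q_def)
    obtain g where "lift_of g (\<rho>' \<gamma>)" using lift[OF \<gamma>(1)] by blast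
    then show "q \<in> Ein_cover" unfolding \<gamma>(2) using y by (rule lift_of_in_cover)
  qed
  moreover have "Q \<noteq> {}" using one_closed by (auto simp: Q_def)
  moreover have "fst q \<le> M" if "q \<in> Q" for q using that M by (auto simp: Q_def)
  ultimately obtain f where f: "lipschitz_height f"
    "\<And>p. p \<in> Ein_cover \<Longrightarrow> (\<exists>q\<in>Q. chron p q) \<longleftrightarrow> fst p < f (snd p)"
    using past_boundary_height by blast
  show ?thesis
  proof
    show "closed_achronal_sphere (height_graph f)" by (rule height_graph_closed_achronal_sphere[OF f(1)])
    fix \<gamma> assume \<gamma>: "\<gamma> \<in> carrier \<Gamma>"
    obtain g where g: "g \<in> carrier SO0" "lift_of g (\<rho>' \<gamma>)" using lift[OF \<gamma>] by blast
    have "\<rho>' \<gamma> ` Q = Q"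
    proof
      show "\<rho>' \<gamma> ` Q \<subseteq> Q"
        using \<gamma> by (auto simp: Q_def mult[symmetric])
      show "Q \<subseteq> \<rho>' \<gamma> ` Q"
      proof
        fix q assume "q \<in> Q"
        then obtain \<gamma>' where \<gamma>': "\<gamma>' \<in> carrier \<Gamma>" "q = \<rho>' \<gamma>' y" by (auto simp: Q_def)
        have "\<gamma> \<otimes>\<^bsub>\<Gamma>\<^esub> (inv\<^bsub>\<Gamma>\<^esub> \<gamma> \<otimes>\<^bsub>\<Gamma>\<^esub> \<gamma>') = \<gamma>'"
          using \<gamma> \<gamma>'(1) by (simp add: m_assoc[symmetric])
        then have "q = \<rho>' \<gamma> (\<rho>' (inv\<^bsub>\<Gamma>\<^esub> \<gamma> \<otimes>\<^bsub>\<Gamma>\<^esub> \<gamma>') y)"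
          using mult[OF \<gamma>, of "inv\<^bsub>\<Gamma>\<^esub> \<gamma> \<otimes>\<^bsub>\<Gamma>\<^esub> \<gamma>'"] \<gamma> \<gamma>' by simp
        then show "q \<in> \<rho>' \<gamma> ` Q" using \<gamma> \<gamma>' by (auto simp: Q_def)
      qed
    qed
    moreover have "bij_betw (\<rho>' \<gamma>) Ein_cover Ein_cover" using lift_of_Bij[OF g(2)] by (simp add: Bij_def)
    ultimately show "\<rho>' \<gamma> ` height_graph f = height_graph f"
      using height_graph_invariant[OF f(1) QS f(2)] lift_chron_iff[OF n g] by blast
  qed
qed

lemma lift_if_euler_coboundary:
  fixes \<Gamma> :: "('g, 'm) monoid_scheme" and \<rho> :: "'g \<Rightarrow> ('n::finite r2n \<Rightarrow>\<^sub>L 'n r2n)" and x0 :: "real ^ 'n"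
  assumes n: "CARD('n) \<ge> 2" and x0: "norm x0 = 1" and hom: "\<rho> \<in> hom \<Gamma> SO0"
    and b: "\<And>\<gamma> \<eta>. \<gamma> \<in> carrier \<Gamma> \<Longrightarrow> \<eta> \<in> carrier \<Gamma> \<Longrightarrow>
      euler_cocycle x0 (\<rho> \<gamma>, \<rho> \<eta>) = b \<eta> - b (\<gamma> \<otimes>\<^bsub>\<Gamma>\<^esub> \<eta>) + b \<gamma>"
  shows "(\<lambda>\<gamma>. deck_shift (b \<gamma>) \<otimes>\<^bsub>SO0_cover\<^esub> lift_section x0 (\<rho> \<gamma>)) \<in> hom \<Gamma> SO0_cover"
proof (rule homI)
  note s = lift_section_props(1)[OF n x0]
  fix \<gamma> assume \<gamma>: "\<gamma> \<in> carrier \<Gamma>"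
  then have r\<gamma>: "\<rho> \<gamma> \<in> carrier SO0" using hom by (simp add: hom_in_carrier)
  then show "deck_shift (b \<gamma>) \<otimes>\<^bsub>SO0_cover\<^esub> lift_section x0 (\<rho> \<gamma>) \<in> carrier SO0_cover"
    using deck_shift_mult_lift[OF s] carrier_SO0_cover by blast
  fix \<eta> assume \<eta>: "\<eta> \<in> carrier \<Gamma>"
  then have r\<eta>: "\<rho> \<eta> \<in> carrier SO0" using hom by (simp add: hom_in_carrier)
  have prod: "lift_of (\<rho> \<gamma> o\<^sub>L \<rho> \<eta>) (lift_section x0 (\<rho> \<gamma>) \<otimes>\<^bsub>SO0_cover\<^esub> lift_section x0 (\<rho> \<eta>))"
    using lift_of_compose[OF s[OF r\<gamma>] s[OF r\<eta>]] by (simp add: SO0_cover_mult[OF s[OF r\<gamma>] s[OF r\<eta>]])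
  have "\<rho> (\<gamma> \<otimes>\<^bsub>\<Gamma>\<^esub> \<eta>) = \<rho> \<gamma> o\<^sub>L \<rho> \<eta>" using hom_mult[OF hom \<gamma> \<eta>] by simp
  then show "deck_shift (b (\<gamma> \<otimes>\<^bsub>\<Gamma>\<^esub> \<eta>)) \<otimes>\<^bsub>SO0_cover\<^esub> lift_section x0 (\<rho> (\<gamma> \<otimes>\<^bsub>\<Gamma>\<^esub> \<eta>)) =
      (deck_shift (b \<gamma>) \<otimes>\<^bsub>SO0_cover\<^esub> lift_section x0 (\<rho> \<gamma>)) \<otimes>\<^bsub>SO0_cover\<^esub>
      (deck_shift (b \<eta>) \<otimes>\<^bsub>SO0_cover\<^esub> lift_section x0 (\<rho> \<eta>))"
    unfolding deck_shift_mult_mult[OF n s[OF r\<gamma>] r\<gamma> s[OF r\<eta>] r\<eta>]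
    by (simp add: euler_cocycle_lift_section[OF n x0 r\<gamma> r\<eta>] deck_shift_mult_assoc[OF prod SO0_compose[OF r\<gamma> r\<eta>]]
        b[OF \<gamma> \<eta>] add.commute)
qed

text \<open>
  Any lifts of \<open>g\<close> and \<open>h\<close>, multiplicative or not, compute the cocycle from their offsets to the section.
\<close>

lemma euler_cocycle_of_lift:
  fixes x0 :: "real ^ 'n::finite" and F H :: "real \<times> (real ^ 'n) \<Rightarrow> real \<times> (real ^ 'n)"
  assumes n: "CARD('n) \<ge> 2" and x0: "norm x0 = 1" and g: "g \<in> carrier SO0" and h: "h \<in> carrier SO0"
    and F: "lift_of g F" and H: "lift_of h H"
    and k: "lift_section x0 g = deck_shift k \<otimes>\<^bsub>SO0_cover\<^esub> F"
    and l: "lift_section x0 h = deck_shift l \<otimes>\<^bsub>SO0_cover\<^esub> H"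
    and m: "lift_section x0 (g o\<^sub>L h) = deck_shift m \<otimes>\<^bsub>SO0_cover\<^esub> (F \<otimes>\<^bsub>SO0_cover\<^esub> H)"
  shows "euler_cocycle x0 (g, h) = m - k - l"
proof (rule euler_cocycle_eqI[OF n x0 g h])
  have prod: "lift_of (g o\<^sub>L h) (F \<otimes>\<^bsub>SO0_cover\<^esub> H)"
    using lift_of_compose[OF F H] by (simp add: SO0_cover_mult[OF F H])
  show "lift_section x0 (g o\<^sub>L h) =
      deck_shift (m - k - l) \<otimes>\<^bsub>SO0_cover\<^esub> (lift_section x0 g \<otimes>\<^bsub>SO0_cover\<^esub> lift_section x0 h)"
    unfolding k l m deck_shift_mult_mult[OF n F g H h] deck_shift_mult_assoc[OF prod SO0_compose[OF g h]]
    by simp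
qed

text \<open>
  The section raises or lowers the base point by at most \<open>\<pi>\<close>, \<open>F\<close> changes the height of \<open>p\<close> by at most \<open>2 M\<close>, and
  the vertical displacements of \<open>F\<close> at the two points differ by less than \<open>3 \<pi>\<close>.
\<close>

lemma section_defect_bounded:
  fixes x0 :: "real ^ 'n::finite" and F :: "real \<times> (real ^ 'n) \<Rightarrow> real \<times> (real ^ 'n)"
  assumes n: "CARD('n) \<ge> 2" and x0: "norm x0 = 1" and g: "g \<in> carrier SO0" and F: "lift_of g F"
    and k: "lift_section x0 g = deck_shift k \<otimes>\<^bsub>SO0_cover\<^esub> F"
    and p: "p \<in> Ein_cover" and M: "\<bar>fst p\<bar> \<le> M" "\<bar>fst (F p)\<bar> \<le> M"
  shows "2 * pi * \<bar>of_int k\<bar> \<le> 4 * pi + 2 * M"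
proof -
  have base: "(0, x0) \<in> Ein_cover" using x0 by (simp add: Ein_cover_iff)
  have "fst (F (0, x0)) + 2 * pi * of_int k \<in> {- pi..<pi}"
    using lift_section_props(2)[OF n x0 g] by (simp only: k deck_shift_mult_apply[OF F base] shift_simps)
  then have "\<bar>2 * pi * of_int k\<bar> \<le> 4 * pi + 2 * M"
    using lift_displacement_oscillation[OF n g F base p] lift_displacement_oscillation[OF n g F p base] M
    by (auto simp: abs_le_iff)
  then show ?thesis by (simp add: abs_mult)
qed

section \<open>Vanishing of the bounded Euler class\<close>

theorem proposition7p3:
  fixes \<Gamma> :: "('g, 'm) monoid_scheme"
    and \<rho> :: "'g \<Rightarrow> ('n::finite r2n \<Rightarrow>\<^sub>L 'n r2n)"
    and x0 :: "real ^ 'n"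
  assumes "CARD('n) \<ge> 2"
    and "x0 \<in> sphere 0 1"
    and "group \<Gamma>"
    and "\<rho> \<in> hom \<Gamma> SO0"
  shows "bounded_euler_class x0 \<Gamma> \<rho> = \<one>\<^bsub>H2b \<Gamma>\<^esub> \<longleftrightarrow>
    (\<exists>\<rho>'\<in>hom \<Gamma> SO0_cover. (\<forall>\<gamma>\<in>carrier \<Gamma>. lift_of (\<rho> \<gamma>) (\<rho>' \<gamma>)) \<and>
       (\<exists>\<Lambda>. closed_achronal_sphere \<Lambda> \<and> (\<forall>\<gamma>\<in>carrier \<Gamma>. \<rho>' \<gamma> ` \<Lambda> = \<Lambda>)))"
    (is "_ \<longleftrightarrow> ?lift")
proof -
  interpret group \<Gamma> by (rule assms(3))
  note n = assms(1)
  have x0: "norm x0 = 1" using assms(2) by simp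
  have base: "(0, x0) \<in> Ein_cover" using x0 by (simp add: Ein_cover_iff)
  have \<rho>: "\<rho> \<gamma> \<in> carrier SO0" if "\<gamma> \<in> carrier \<Gamma>" for \<gamma> using assms(4) that by (rule hom_in_carrier)
  have \<rho>_mult: "\<rho> (\<gamma> \<otimes>\<^bsub>\<Gamma>\<^esub> \<eta>) = \<rho> \<gamma> o\<^sub>L \<rho> \<eta>" if "\<gamma> \<in> carrier \<Gamma>" "\<eta> \<in> carrier \<Gamma>" for \<gamma> \<eta>
    using hom_mult[OF assms(4) that] by simp
  let ?c = "cochain_pullback \<Gamma> \<rho> (euler_cocycle x0)"
  have "bounded_euler_class x0 \<Gamma> \<rho> = \<one>\<^bsub>H2b \<Gamma>\<^esub> \<longleftrightarrow> ?c \<in> bounded_coboundaries2 \<Gamma>"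
    unfolding bounded_euler_class_def
    by (rule H2b_class_trivial_iff[OF assms(3)]) (simp add: cochain_pullback_def)
  also have "\<dots> \<longleftrightarrow> ?lift"
  proof
    assume "?c \<in> bounded_coboundaries2 \<Gamma>"
    then obtain b where b: "b \<in> bounded_cochains1 \<Gamma>" and cb: "?c = coboundary1 \<Gamma> b"
      by (auto simp: bounded_coboundaries2_def)
    obtain K where K: "\<And>\<gamma>. \<gamma> \<in> carrier \<Gamma> \<Longrightarrow> \<bar>b \<gamma>\<bar> \<le> K" using b by (auto simp: bounded_cochains1_def)
    have c: "euler_cocycle x0 (\<rho> \<gamma>, \<rho> \<eta>) = b \<eta> - b (\<gamma> \<otimes>\<^bsub>\<Gamma>\<^esub> \<eta>) + b \<gamma>"
      if "\<gamma> \<in> carrier \<Gamma>" "\<eta> \<in> carrier \<Gamma>" for \<gamma> \<eta>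
      using fun_cong[OF cb, of "(\<gamma>, \<eta>)"] that by (simp add: cochain_pullback_def coboundary1_def)
    \<comment> \<open>The cocycle identity for b is exactly the condition that this product is multiplicative.\<close>
    define \<rho>' where "\<rho>' = (\<lambda>\<gamma>. deck_shift (b \<gamma>) \<otimes>\<^bsub>SO0_cover\<^esub> lift_section x0 (\<rho> \<gamma>))"
    have hom: "\<rho>' \<in> hom \<Gamma> SO0_cover"
      unfolding \<rho>'_def using c by (rule lift_if_euler_coboundary[OF n x0 assms(4)])
    note s = lift_section_props[OF n x0 \<rho>]
    have "fst (\<rho>' \<gamma> (0, x0)) \<le> pi + 2 * pi * of_int K" if \<gamma>: "\<gamma> \<in> carrier \<Gamma>" for \<gamma>
    proof -
      have "(of_int (b \<gamma>) :: real) \<le> of_int K" using K[OF \<gamma>] by simp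
      then have "2 * pi * of_int (b \<gamma>) \<le> 2 * pi * of_int K" by (intro mult_left_mono) auto
      moreover have "fst (\<rho>' \<gamma> (0, x0)) = fst (lift_section x0 (\<rho> \<gamma>) (0, x0)) + 2 * pi * of_int (b \<gamma>)"
        by (simp add: \<rho>'_def deck_shift_mult_apply[OF s(1)[OF \<gamma>] base])
      ultimately show ?thesis
        using s(2)[OF \<gamma>] unfolding atLeastLessThan_iff by linarith
    qed
    then obtain \<Lambda> where "closed_achronal_sphere \<Lambda>" "\<And>\<gamma>. \<gamma> \<in> carrier \<Gamma> \<Longrightarrow> \<rho>' \<gamma> ` \<Lambda> = \<Lambda>"
      using bounded_lift_preserves_sphere[OF n assms(3) hom base] by blast
    moreover have "lift_of (\<rho> \<gamma>) (\<rho>' \<gamma>)" if "\<gamma> \<in> carrier \<Gamma>" for \<gamma>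
      unfolding \<rho>'_def by (rule deck_shift_mult_lift[OF s(1)[OF that]])
    ultimately show ?lift using hom by blast
  next
    assume ?lift
    then obtain \<rho>' \<Lambda> where hom: "\<rho>' \<in> hom \<Gamma> SO0_cover"
      and lift: "\<And>\<gamma>. \<gamma> \<in> carrier \<Gamma> \<Longrightarrow> lift_of (\<rho> \<gamma>) (\<rho>' \<gamma>)"
      and \<Lambda>: "closed_achronal_sphere \<Lambda>" and inv: "\<And>\<gamma>. \<gamma> \<in> carrier \<Gamma> \<Longrightarrow> \<rho>' \<gamma> ` \<Lambda> = \<Lambda>"
      by blast
    have \<Lambda>S: "\<Lambda> \<subseteq> Ein_cover" and sph: "\<Lambda> homeomorphic sphere (0 :: real ^ 'n) 1"
      using \<Lambda> by (auto simp: closed_achronal_sphere_def)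
    have "\<exists>k. lift_section x0 (\<rho> \<gamma>) = deck_shift k \<otimes>\<^bsub>SO0_cover\<^esub> \<rho>' \<gamma>" if \<gamma>: "\<gamma> \<in> carrier \<Gamma>" for \<gamma>
      using lifts_differ_by_deck_shift[OF n lift[OF \<gamma>] lift_section_props(1)[OF n x0 \<rho>[OF \<gamma>]]] by blast
    then obtain k where k: "\<And>\<gamma>. \<gamma> \<in> carrier \<Gamma> \<Longrightarrow>
        lift_section x0 (\<rho> \<gamma>) = deck_shift (k \<gamma>) \<otimes>\<^bsub>SO0_cover\<^esub> \<rho>' \<gamma>"
      by metis
    have "compact \<Lambda>" using homeomorphic_compactness[OF sph] by simp
    then have "compact (fst ` \<Lambda>)" by (intro compact_continuous_image continuous_intros)
    then obtain M where M: "\<And>p. p \<in> \<Lambda> \<Longrightarrow> \<bar>fst p\<bar> \<le> M"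
      using bounded_iff[of "fst ` \<Lambda>"] compact_imp_bounded by auto
    have "\<Lambda> \<noteq> {}" using sph x0 by (auto simp: homeomorphic_empty)
    then obtain p where p: "p \<in> \<Lambda>" by blast
    have bound: "\<bar>k \<gamma>\<bar> \<le> \<lceil>4 * pi + 2 * M\<rceil>" if \<gamma>: "\<gamma> \<in> carrier \<Gamma>" for \<gamma>
    proof -
      have "\<rho>' \<gamma> p \<in> \<Lambda>" using inv[OF \<gamma>] p by blast
      then have "2 * pi * \<bar>of_int (k \<gamma>)\<bar> \<le> 4 * pi + 2 * M"
        using p \<Lambda>S M by (intro section_defect_bounded[OF n x0 \<rho>[OF \<gamma>] lift[OF \<gamma>] k[OF \<gamma>], of p]) auto
      moreover have "1 * \<bar>of_int (k \<gamma>)\<bar> \<le> 2 * pi * \<bar>of_int (k \<gamma>) :: real\<bar>"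
        using pi_ge_two by (intro mult_right_mono) auto
      ultimately have "of_int \<bar>k \<gamma>\<bar> \<le> 4 * pi + 2 * M" by simp
      then show ?thesis by linarith
    qed
    \<comment> \<open>Counting powers of the deck transformation gives c = k (\<gamma> \<eta>) - k \<gamma> - k \<eta>, the coboundary of - k.\<close>
    let ?b = "\<lambda>\<gamma>\<in>carrier \<Gamma>. - k \<gamma>"
    have "?b \<in> bounded_cochains1 \<Gamma>" using bound by (auto simp: bounded_cochains1_def)
    moreover have "?c = coboundary1 \<Gamma> ?b"
    proof (rule ext)
      fix q show "?c q = coboundary1 \<Gamma> ?b q"
      proof (cases "q \<in> carrier \<Gamma> \<times> carrier \<Gamma>")
        case True
        then obtain \<gamma> \<eta> where q: "q = (\<gamma>, \<eta>)" "\<gamma> \<in> carrier \<Gamma>" "\<eta> \<in> carrier \<Gamma>" by blast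
        have "lift_section x0 (\<rho> \<gamma> o\<^sub>L \<rho> \<eta>) =
            deck_shift (k (\<gamma> \<otimes>\<^bsub>\<Gamma>\<^esub> \<eta>)) \<otimes>\<^bsub>SO0_cover\<^esub> (\<rho>' \<gamma> \<otimes>\<^bsub>SO0_cover\<^esub> \<rho>' \<eta>)"
          using k[of "\<gamma> \<otimes>\<^bsub>\<Gamma>\<^esub> \<eta>"] q by (simp add: \<rho>_mult hom_mult[OF hom])
        then have "euler_cocycle x0 (\<rho> \<gamma>, \<rho> \<eta>) = k (\<gamma> \<otimes>\<^bsub>\<Gamma>\<^esub> \<eta>) - k \<gamma> - k \<eta>"
          using q by (intro euler_cocycle_of_lift[OF n x0 \<rho> \<rho> lift lift k k])
        then show ?thesis using q by (simp add: cochain_pullback_def coboundary1_def)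
      next
        case False
        then show ?thesis by (simp add: cochain_pullback_def coboundary1_def)
      qed
    qed
    ultimately show "?c \<in> bounded_coboundaries2 \<Gamma>" by (auto simp: bounded_coboundaries2_def)
  qed
  finally show ?thesis .
qed

end
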